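(* Let $\mu$ be a Borel measure on $\mathbb{R}$ with support contained in $[-1,1]$ and with $v_j\in L^1(\mu)$ for all $j\in\mathbb{N}_0$, where $v_j(x)=x^j$. Let $w=\{w_i\}_{i\in\mathbb{N}_0}$ be weights such that $$\sum_{j\in\mathbb{N}_0}\frac{1}{w_j}|M_{j+k}|^2<\infty\quad\text{for all } k\in\mathbb{N}_0,$$ where $M_n=\int x^n\,\mathrm{d}\mu(x)$ (so that the adjoint $F_w^*$ below has dense domain as an operator into $\ell^2(w)$). Let $F$ be the closure of the operator from $\ell^2(w)$ to $L^2(\mu)$ which sends a finitely supported sequence $c\in\mathcal{D}$ to the polynomial $f_c(x)=\sum_ic_ix^i$. Then the operator $K=FF_w^*$ is a self-adjoint operator in $L^2(\mu)$ with dense domain. On its domain, $K$ is an integral operator with kernel $$k(x,y)=\sum_{j}\frac{(xy)^j}{w_j},$$ i.e. $(K\phi)(x)=\int k(x,y)\phi(y)\,\mathrm{d}\mu(y)$ for $\phi\in\mathrm{dom}(K)$.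
   Context: $\mathcal{D}$ is the space of finitely supported complex sequences indexed by $\mathbb{N}_0$. Weights satisfy $w_i>0$; $\ell^2(w)=\{c:\sum_iw_i|c_i|^2<\infty\}$ with $\langle c|d\rangle_{\ell^2(w)}=\sum_iw_i\overline{c_i}d_i$. $F_w^*:L^2(\mu)\to\ell^2(w)$ is the adjoint of $F$; it is given by $(F_w^*\phi)_k=\frac{1}{w_k}\int x^k\phi(x)\,\mathrm{d}\mu(x)$. *)

theory Defs
  imports "HOL-Analysis.Analysis"
begin

text \<open>
  A Hilbert space of complex-valued functions is given by its set of vectors and its inner
  product, which is conjugate-linear in the first argument. Vectors at distance zero are
  identified: for \<open>L2 \<mu>\<close> this is equality almost everywhere, while for \<open>ell2 w\<close> with positive
  weights it is equality.
\<close>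

record 'i hilbert =
  vectors :: "('i \<Rightarrow> complex) set"
  ip :: "('i \<Rightarrow> complex) \<Rightarrow> ('i \<Rightarrow> complex) \<Rightarrow> complex"

definition hnorm :: "'i hilbert \<Rightarrow> ('i \<Rightarrow> complex) \<Rightarrow> real" where
  "hnorm H f = sqrt (Re (ip H f f))"

definition ell2 :: "(nat \<Rightarrow> real) \<Rightarrow> nat hilbert" where
  "ell2 w = \<lparr> vectors = {c. summable (\<lambda>i. w i * (cmod (c i))\<^sup>2)},
              ip = (\<lambda>c d. \<Sum>i. complex_of_real (w i) * cnj (c i) * d i) \<rparr>"

definition L2 :: "'i measure \<Rightarrow> 'i hilbert" where
  "L2 \<mu> = \<lparr> vectors = {\<phi> \<in> borel_measurable \<mu>. integrable \<mu> (\<lambda>x. (cmod (\<phi> x))\<^sup>2)},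
            ip = (\<lambda>\<phi> \<psi>. \<integral>x. cnj (\<phi> x) * \<psi> x \<partial>\<mu>) \<rparr>"


text \<open>
  Unbounded operators are represented by their graphs. The domain is \<open>Domain T\<close>, and the
  composition of \<open>T\<close> with \<open>S\<close> applied first is the relational composition \<open>S O T\<close>.
\<close>

definition linear_operator ::
  "'i hilbert \<Rightarrow> 'j hilbert \<Rightarrow> (('i \<Rightarrow> complex) \<times> ('j \<Rightarrow> complex)) set \<Rightarrow> bool" where
  "linear_operator H\<^sub>1 H\<^sub>2 T \<longleftrightarrow>
     T \<subseteq> vectors H\<^sub>1 \<times> vectors H\<^sub>2 \<and>
     ((\<lambda>_. 0), (\<lambda>_. 0)) \<in> T \<and>
     (\<forall>(f, g) \<in> T. \<forall>(f', g') \<in> T. \<forall>a b.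
        ((\<lambda>i. a * f i + b * f' i), (\<lambda>j. a * g j + b * g' j)) \<in> T) \<and>
     (\<forall>(f, g) \<in> T. \<forall>(f', g') \<in> T. hnorm H\<^sub>1 (f - f') = 0 \<longrightarrow> hnorm H\<^sub>2 (g - g') = 0)"

definition densely_defined ::
  "'i hilbert \<Rightarrow> (('i \<Rightarrow> complex) \<times> ('j \<Rightarrow> complex)) set \<Rightarrow> bool" where
  "densely_defined H T \<longleftrightarrow>
     (\<forall>f \<in> vectors H. \<forall>\<epsilon>>0. \<exists>g \<in> Domain T. hnorm H (f - g) < \<epsilon>)"

definition closure_op ::
  "'i hilbert \<Rightarrow> 'j hilbert \<Rightarrow> (('i \<Rightarrow> complex) \<times> ('j \<Rightarrow> complex)) set
     \<Rightarrow> (('i \<Rightarrow> complex) \<times> ('j \<Rightarrow> complex)) set" where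
  "closure_op H\<^sub>1 H\<^sub>2 T =
     {(f, g) \<in> vectors H\<^sub>1 \<times> vectors H\<^sub>2.
        \<forall>\<epsilon>>0. \<exists>(f', g') \<in> T. hnorm H\<^sub>1 (f - f') < \<epsilon> \<and> hnorm H\<^sub>2 (g - g') < \<epsilon>}"

definition adjoint_op ::
  "'i hilbert \<Rightarrow> 'j hilbert \<Rightarrow> (('i \<Rightarrow> complex) \<times> ('j \<Rightarrow> complex)) set
     \<Rightarrow> (('j \<Rightarrow> complex) \<times> ('i \<Rightarrow> complex)) set" where
  "adjoint_op H\<^sub>1 H\<^sub>2 T =
     {(g, f) \<in> vectors H\<^sub>2 \<times> vectors H\<^sub>1. \<forall>(f', g') \<in> T. ip H\<^sub>2 g g' = ip H\<^sub>1 f f'}"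

definition self_adjoint ::
  "'i hilbert \<Rightarrow> (('i \<Rightarrow> complex) \<times> ('i \<Rightarrow> complex)) set \<Rightarrow> bool" where
  "self_adjoint H T \<longleftrightarrow>
     linear_operator H H T \<and> densely_defined H T \<and> adjoint_op H H T = T"


text \<open>The complement of the largest open null set.\<close>

definition measure_support :: "'a::topological_space measure \<Rightarrow> 'a set" where
  "measure_support \<mu> = {x. \<forall>U. open U \<longrightarrow> x \<in> U \<longrightarrow> emeasure \<mu> U > 0}"

definition moment :: "real measure \<Rightarrow> nat \<Rightarrow> real" where
  "moment \<mu> n = (\<integral>x. x ^ n \<partial>\<mu>)"

definition fin_seqs :: "(nat \<Rightarrow> complex) set" where
  "fin_seqs = {c. finite {i. c i \<noteq> 0}}"

definition poly_fun :: "(nat \<Rightarrow> complex) \<Rightarrow> real \<Rightarrow> complex" where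
  "poly_fun c x = (\<Sum>i | c i \<noteq> 0. c i * complex_of_real x ^ i)"

definition F_op :: "(nat \<Rightarrow> real) \<Rightarrow> real measure \<Rightarrow> ((nat \<Rightarrow> complex) \<times> (real \<Rightarrow> complex)) set" where
  "F_op w \<mu> = closure_op (ell2 w) (L2 \<mu>) {(c, poly_fun c) | c. c \<in> fin_seqs}"

definition F_adj :: "(nat \<Rightarrow> real) \<Rightarrow> real measure \<Rightarrow> ((real \<Rightarrow> complex) \<times> (nat \<Rightarrow> complex)) set" where
  "F_adj w \<mu> = adjoint_op (ell2 w) (L2 \<mu>) (F_op w \<mu>)"

definition K_op :: "(nat \<Rightarrow> real) \<Rightarrow> real measure \<Rightarrow> ((real \<Rightarrow> complex) \<times> (real \<Rightarrow> complex)) set" where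
  "K_op w \<mu> = F_adj w \<mu> O F_op w \<mu>"

definition K_kernel :: "(nat \<Rightarrow> real) \<Rightarrow> real \<Rightarrow> real \<Rightarrow> real" where
  "K_kernel w x y = (\<Sum>j. (x * y) ^ j / w j)"

end

theory Submission
  imports Defs
begin

text \<open>
  The operator \<open>F\<close> is closable because its adjoint is densely defined: by the assumption on the
  moments, \<open>dom F\<^sub>w\<^sup>*\<close> contains all monomials, and polynomials are dense in \<open>L2 \<mu>\<close>, since the moments
  of an integrable function on a compact interval determine it almost everywhere. Self-adjointness
  of \<open>K = F F\<^sub>w\<^sup>*\<close> is von Neumann's theorem: projecting \<open>(0, h)\<close> onto the graph of \<open>F\<close> shows that
  \<open>I + K\<close> is onto, and a symmetric operator with this property is self-adjoint.

  For the kernel, let \<open>r\<close> be the essential supremum of \<open>|x|\<close>. If \<open>\<mu> {y. s \<le> |y|} = m > 0\<close>, then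
  \<open>M\<^sub>n \<ge> m s\<^sup>n\<close> for even \<open>n\<close>, so the assumption on the moments with \<open>k = 0\<close> and \<open>k = 1\<close> yields the
  convergence of \<open>\<Sum>j. s\<^sup>2\<^sup>j / w\<^sub>j\<close>. Hence \<open>\<Sum>j. (|x| r)\<^sup>j / w\<^sub>j\<close> converges for almost every \<open>x\<close>. For such
  \<open>x\<close> the kernel \<open>k(x, \<cdot>)\<close> is essentially bounded, evaluation at \<open>x\<close> is continuous on \<open>ell2 w\<close>, and
  sum and integral may be interchanged in \<open>\<Sum>j. x\<^sup>j (F\<^sub>w\<^sup>* \<phi>)\<^sub>j\<close>.
\<close>

section \<open>Hilbert spaces of functions\<close>

text \<open>The inner product is only assumed semidefinite: in \<open>L2\<close> a vector of norm
  zero is a null function, not the zero function. Accordingly limits, in \<open>complete\<close> as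
  well, are determined only up to null vectors.\<close>

locale hilbert_space =
  fixes H :: "'i hilbert"
  assumes zero_mem: "(\<lambda>_. 0) \<in> vectors H"
    and lincomb_mem:
      "\<lbrakk>f \<in> vectors H; g \<in> vectors H\<rbrakk> \<Longrightarrow> (\<lambda>i. a * f i + b * g i) \<in> vectors H"
    and ip_lincomb_right:
      "\<lbrakk>h \<in> vectors H; f \<in> vectors H; g \<in> vectors H\<rbrakk>
        \<Longrightarrow> ip H h (\<lambda>i. a * f i + b * g i) = a * ip H h f + b * ip H h g"
    and ip_commute: "\<lbrakk>f \<in> vectors H; g \<in> vectors H\<rbrakk> \<Longrightarrow> ip H g f = cnj (ip H f g)"
    and ip_nonneg: "f \<in> vectors H \<Longrightarrow> 0 \<le> Re (ip H f f)"
    and complete: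
      "\<lbrakk>\<And>n::nat. X n \<in> vectors H;
        \<And>e. 0 < e \<Longrightarrow> \<exists>N. \<forall>m\<ge>N. \<forall>n\<ge>N. hnorm H (X m - X n) < e\<rbrakk>
        \<Longrightarrow> \<exists>l\<in>vectors H. (\<lambda>n. hnorm H (X n - l)) \<longlonglongrightarrow> 0"
begin

lemma diff_mem: "\<lbrakk>f \<in> vectors H; g \<in> vectors H\<rbrakk> \<Longrightarrow> f - g \<in> vectors H"
  using lincomb_mem[of f g 1 "-1"] by (simp add: fun_diff_def)

lemma scale_mem: "f \<in> vectors H \<Longrightarrow> (\<lambda>i. a * f i) \<in> vectors H"
  using lincomb_mem[of f f a 0] by simp

lemma ip_lincomb_left:
  assumes "h \<in> vectors H" "f \<in> vectors H" "g \<in> vectors H"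
  shows "ip H (\<lambda>i. a * f i + b * g i) h = cnj a * ip H f h + cnj b * ip H g h"
proof -
  have "ip H (\<lambda>i. a * f i + b * g i) h = cnj (ip H h (\<lambda>i. a * f i + b * g i))"
    using assms by (intro ip_commute lincomb_mem)
  also have "\<dots> = cnj a * cnj (ip H h f) + cnj b * cnj (ip H h g)"
    using assms by (simp add: ip_lincomb_right)
  also have "\<dots> = cnj a * ip H f h + cnj b * ip H g h"
    using assms by (simp add: ip_commute[of h f] ip_commute[of h g])
  finally show ?thesis .
qed

lemma ip_diff_right:
  "\<lbrakk>h \<in> vectors H; f \<in> vectors H; g \<in> vectors H\<rbrakk> \<Longrightarrow> ip H h (f - g) = ip H h f - ip H h g"
  using ip_lincomb_right[of h f g 1 "-1"] by (simp add: fun_diff_def)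

lemma ip_diff_left:
  "\<lbrakk>h \<in> vectors H; f \<in> vectors H; g \<in> vectors H\<rbrakk> \<Longrightarrow> ip H (f - g) h = ip H f h - ip H g h"
  using ip_lincomb_left[of h f g 1 "-1"] by (simp add: fun_diff_def)

lemma ip_zero_left: "h \<in> vectors H \<Longrightarrow> ip H (\<lambda>_. 0) h = 0"
  using ip_lincomb_left[of h h h 0 0] by simp

lemma hnorm_nonneg: "f \<in> vectors H \<Longrightarrow> 0 \<le> hnorm H f"
  by (simp add: hnorm_def ip_nonneg)

lemma hnorm_square: "f \<in> vectors H \<Longrightarrow> (hnorm H f)\<^sup>2 = Re (ip H f f)"
  by (simp add: hnorm_def ip_nonneg)

lemma ip_self: "f \<in> vectors H \<Longrightarrow> ip H f f = complex_of_real ((hnorm H f)\<^sup>2)"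
  using ip_commute[of f f] by (simp add: hnorm_square complex_eq_iff)

lemma hnorm_lincomb_square:
  assumes "f \<in> vectors H" "g \<in> vectors H"
  shows "(hnorm H (\<lambda>i. a * f i + b * g i))\<^sup>2
    = (cmod a)\<^sup>2 * (hnorm H f)\<^sup>2 + (cmod b)\<^sup>2 * (hnorm H g)\<^sup>2 + 2 * Re (cnj a * b * ip H f g)"
proof -
  note m = assms lincomb_mem[OF assms]
  have "ip H (\<lambda>i. a * f i + b * g i) (\<lambda>i. a * f i + b * g i)
     = cnj a * (a * ip H f f + b * ip H f g) + cnj b * (a * cnj (ip H f g) + b * ip H g g)"
    using m by (simp add: ip_lincomb_left ip_lincomb_right ip_commute[of f g])
  also have "\<dots> = (a * cnj a) * ip H f f + (b * cnj b) * ip H g g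
      + (cnj a * b * ip H f g + cnj (cnj a * b * ip H f g))"
    by (simp add: algebra_simps)
  also have "\<dots> = complex_of_real ((cmod a)\<^sup>2 * (hnorm H f)\<^sup>2 + (cmod b)\<^sup>2 * (hnorm H g)\<^sup>2
      + 2 * Re (cnj a * b * ip H f g))"
    unfolding complex_add_cnj using assms by (simp add: ip_self complex_norm_square[symmetric])
  finally show ?thesis
    using m by (simp add: hnorm_square del: of_real_add of_real_mult)
qed

lemma hnorm_scale: "f \<in> vectors H \<Longrightarrow> hnorm H (\<lambda>i. a * f i) = cmod a * hnorm H f"
  using hnorm_lincomb_square[of f f a 0]
  by (simp add: power_mult_distrib[symmetric] hnorm_nonneg scale_mem)

lemma hnorm_commute: "\<lbrakk>f \<in> vectors H; g \<in> vectors H\<rbrakk> \<Longrightarrow> hnorm H (f - g) = hnorm H (g - f)"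
  using hnorm_scale[OF diff_mem[of g f], of "-1"] by (simp add: fun_diff_def)

lemma hnorm_zero: "hnorm H (\<lambda>_. 0) = 0"
  using hnorm_scale[OF zero_mem, of 0] by simp

end

section \<open>Cauchy-Schwarz, orthogonal projection and density criteria\<close>

text \<open>For a > 0 the quadratic in s is evaluated at its minimum s = 1/a. For a = 0 it is linear
  in s, and B > 0 would make it equal to -1 at s = (D + 1) / (2 B).\<close>

lemma le_of_quadratic_nonneg:
  fixes D B a :: real
  assumes "\<And>s. 0 \<le> D - 2 * s * B + s\<^sup>2 * B * a" "0 \<le> B" "0 \<le> a"
  shows "B \<le> D * a"
proof (cases "a = 0")
  case True
  have "B = 0"
  proof (rule ccontr)
    assume "B \<noteq> 0"
    with assms(1)[of "(D + 1) / (2 * B)"] True show False by simp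
  qed
  with True show ?thesis by simp
next
  case False
  with assms(3) have "0 < a" by simp
  have "0 \<le> a * (D - 2 * (1 / a) * B + (1 / a)\<^sup>2 * B * a)"
    using assms(1)[of "1 / a"] \<open>0 < a\<close> by (intro mult_nonneg_nonneg) auto
  also have "\<dots> = D * a - B"
    using \<open>0 < a\<close> by (simp add: field_simps power2_eq_square)
  finally show ?thesis by simp
qed

context hilbert_space
begin

text \<open>With \<open>d = 0\<close> this is the Cauchy--Schwarz inequality; with \<open>d\<close> the squared distance of a point
  to a subspace it shows that a minimizing sequence is asymptotically orthogonal to the subspace.\<close>

lemma ip_le_of_minimal:
  assumes "f \<in> vectors H" "g \<in> vectors H"
    and min: "\<And>t. d \<le> (hnorm H (\<lambda>i. 1 * f i + t * g i))\<^sup>2"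
  shows "(cmod (ip H f g))\<^sup>2 \<le> ((hnorm H f)\<^sup>2 - d) * (hnorm H g)\<^sup>2"
proof (rule le_of_quadratic_nonneg)
  fix s :: real
  let ?b = "ip H f g"
  \<comment> \<open>The factor \<open>cnj ?b\<close> in the coefficient t cancels the phase of the
    inner product, so the cross term is real for every real s.\<close>
  have "Re (cnj 1 * (- complex_of_real s * cnj ?b) * ?b) = - s * (cmod ?b)\<^sup>2"
    unfolding cmod_power2 by (simp add: power2_eq_square algebra_simps)
  with min[of "- complex_of_real s * cnj ?b"] hnorm_lincomb_square[OF assms(1,2), of 1 "- complex_of_real s * cnj ?b"]
  show "0 \<le> ((hnorm H f)\<^sup>2 - d) - 2 * s * (cmod ?b)\<^sup>2 + s\<^sup>2 * (cmod ?b)\<^sup>2 * (hnorm H g)\<^sup>2"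
    by (simp add: norm_mult power_mult_distrib algebra_simps)
qed auto

lemma Cauchy_Schwarz:
  assumes "f \<in> vectors H" "g \<in> vectors H"
  shows "cmod (ip H f g) \<le> hnorm H f * hnorm H g"
proof (rule power2_le_imp_le)
  show "(cmod (ip H f g))\<^sup>2 \<le> (hnorm H f * hnorm H g)\<^sup>2"
    using ip_le_of_minimal[OF assms, of 0] by (simp add: power_mult_distrib)
qed (simp add: assms hnorm_nonneg)

lemma ip_zero_of_hnorm:
  assumes "f \<in> vectors H" "g \<in> vectors H" "hnorm H f = 0"
  shows "ip H f g = 0"
  using Cauchy_Schwarz[OF assms(1,2)] assms(3) by simp

lemma hnorm_zero_iff_ip: "f \<in> vectors H \<Longrightarrow> hnorm H f = 0 \<longleftrightarrow> ip H f f = 0"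
  by (simp add: ip_self)

lemma hnorm_lincomb:
  assumes "f \<in> vectors H" "g \<in> vectors H"
  shows "hnorm H (\<lambda>i. a * f i + b * g i) \<le> cmod a * hnorm H f + cmod b * hnorm H g"
proof (rule power2_le_imp_le)
  have "Re (cnj a * b * ip H f g) \<le> cmod (cnj a * b * ip H f g)"
    by (rule complex_Re_le_cmod)
  also have "\<dots> \<le> cmod a * cmod b * (hnorm H f * hnorm H g)"
    using Cauchy_Schwarz[OF assms] by (simp add: norm_mult mult_left_mono)
  finally show "(hnorm H (\<lambda>i. a * f i + b * g i))\<^sup>2 \<le> (cmod a * hnorm H f + cmod b * hnorm H g)\<^sup>2"
    by (simp add: hnorm_lincomb_square assms power2_sum power_mult_distrib algebra_simps)
qed (simp add: assms hnorm_nonneg)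

lemma hnorm_triangle:
  assumes "f \<in> vectors H" "g \<in> vectors H" "h \<in> vectors H"
  shows "hnorm H (f - h) \<le> hnorm H (f - g) + hnorm H (g - h)"
  using hnorm_lincomb[OF diff_mem diff_mem, of f g g h 1 1] assms by (simp add: fun_diff_def)

lemma hnorm_lincomb_diff:
  assumes "f \<in> vectors H" "g \<in> vectors H" "f' \<in> vectors H" "g' \<in> vectors H"
  shows "hnorm H ((\<lambda>i. a * f i + b * g i) - (\<lambda>i. a * f' i + b * g' i))
    \<le> cmod a * hnorm H (f - f') + cmod b * hnorm H (g - g')"
proof -
  have "(\<lambda>i. a * f i + b * g i) - (\<lambda>i. a * f' i + b * g' i)
      = (\<lambda>i. a * (f - f') i + b * (g - g') i)"
    by (simp add: fun_eq_iff algebra_simps)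
  then show ?thesis
    using hnorm_lincomb[of "f - f'" "g - g'" a b] assms by (simp add: diff_mem)
qed

lemma tendsto_ip_right:
  assumes "h \<in> vectors H" "\<And>n. X n \<in> vectors H" "l \<in> vectors H"
    and "(\<lambda>n. hnorm H (X n - l)) \<longlonglongrightarrow> 0"
  shows "(\<lambda>n. ip H h (X n)) \<longlonglongrightarrow> ip H h l"
proof (subst LIM_zero_iff[symmetric], rule Lim_null_comparison)
  show "\<forall>\<^sub>F n in sequentially. norm (ip H h (X n) - ip H h l) \<le> hnorm H h * hnorm H (X n - l)"
    using Cauchy_Schwarz[OF assms(1) diff_mem] assms(1-3)
    by (intro always_eventually) (simp add: ip_diff_right[symmetric])
  show "(\<lambda>n. hnorm H h * hnorm H (X n - l)) \<longlonglongrightarrow> 0"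
    using tendsto_mult_left[OF assms(4), of "hnorm H h"] by simp
qed

lemma tendsto_ip_left:
  assumes "h \<in> vectors H" "\<And>n. X n \<in> vectors H" "l \<in> vectors H"
    and "(\<lambda>n. hnorm H (X n - l)) \<longlonglongrightarrow> 0"
  shows "(\<lambda>n. ip H (X n) h) \<longlonglongrightarrow> ip H l h"
  using tendsto_cnj[OF tendsto_ip_right[OF assms]] assms(1-3)
  by (simp add: ip_commute[of h, symmetric])

text \<open>The subspace S need not be closed, so p is a projection onto its closure and membership
  is replaced by approximability. The parallelogram law makes a minimizing sequence Cauchy, and p is
  its limit.\<close>

lemma exists_projection:
  assumes sub: "S \<subseteq> vectors H" and zero: "(\<lambda>_. 0) \<in> S"
    and lin: "\<And>f g a b. \<lbrakk>f \<in> S; g \<in> S\<rbrakk> \<Longrightarrow> (\<lambda>i. a * f i + b * g i) \<in> S"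
    and h: "h \<in> vectors H"
  shows "\<exists>p\<in>vectors H. (\<forall>e>0. \<exists>s\<in>S. hnorm H (p - s) < e) \<and> (\<forall>s\<in>S. ip H (h - p) s = 0)"
proof -
  let ?D = "(\<lambda>s. (hnorm H (h - s))\<^sup>2) ` S"
  define d where "d = Inf ?D"
  have bdd: "bdd_below ?D"
    by (rule bdd_belowI[of _ 0]) auto
  have d_le: "d \<le> (hnorm H (h - s))\<^sup>2" if "s \<in> S" for s
    unfolding d_def using that bdd by (intro cInf_lower) auto
  have "\<exists>s\<in>S. (hnorm H (h - s))\<^sup>2 < d + 1 / real (Suc n)" for n
  proof -
    have "Inf ?D < d + 1 / real (Suc n)"
      by (simp add: d_def)
    with zero bdd show ?thesis
      using cInf_less_iff[of ?D] by (auto simp: image_def)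
  qed
  then obtain X where X: "\<And>n. X n \<in> S" "\<And>n. (hnorm H (h - X n))\<^sup>2 < d + 1 / real (Suc n)"
    by metis
  have XV: "X n \<in> vectors H" for n
    using X sub by auto
  have mid: "(hnorm H (X m - X n))\<^sup>2 \<le> 2 / real (Suc m) + 2 / real (Suc n)" for m n
  proof -
    \<comment> \<open>The midpoint lies in S, so its squared distance to h is at least d; the
      parallelogram law then bounds the distance of the two points by their excess over d.\<close>
    let ?m = "\<lambda>i. (1/2) * X m i + (1/2) * X n i"
    have par: "(hnorm H (X m - X n))\<^sup>2 + 4 * (hnorm H (h - ?m))\<^sup>2
      = 2 * (hnorm H (h - X m))\<^sup>2 + 2 * (hnorm H (h - X n))\<^sup>2"
    proof -
      have eq1: "X m - X n = (\<lambda>i. (-1) * (h - X m) i + 1 * (h - X n) i)"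
        by (simp add: fun_eq_iff)
      have eq2: "h - ?m = (\<lambda>i. (1/2) * (h - X m) i + (1/2) * (h - X n) i)"
        by (simp add: fun_eq_iff field_simps)
      show ?thesis
        unfolding eq1 eq2
        by (simp only: hnorm_lincomb_square[OF diff_mem[OF h XV] diff_mem[OF h XV]])
           (simp add: power2_eq_square field_simps)
    qed
    have "d \<le> (hnorm H (h - ?m))\<^sup>2"
      by (intro d_le lin X)
    with par X(2)[of m] X(2)[of n] show ?thesis by simp
  qed
  have "\<exists>N. \<forall>m\<ge>N. \<forall>n\<ge>N. hnorm H (X m - X n) < e" if "0 < e" for e
  proof -
    \<comment> \<open>This makes each of the two terms in \<open>mid\<close> smaller than half of
      e^2.\<close>
    obtain N :: nat where N: "4 / e\<^sup>2 < real N"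
      using reals_Archimedean2 by blast
    have "hnorm H (X m - X n) < e" if "m \<ge> N" "n \<ge> N" for m n
    proof (rule power2_less_imp_less)
      have "0 < 4 / e\<^sup>2" using \<open>0 < e\<close> by simp
      with N have "0 < real N" by linarith
      have "2 / real (Suc k) < e\<^sup>2 / 2" if "k \<ge> N" for k
      proof -
        have "4 / e\<^sup>2 < real (Suc k)" using N that by linarith
        then show ?thesis using \<open>0 < e\<close> by (simp add: field_simps)
      qed
      from this[OF that(1)] this[OF that(2)] mid[of m n]
      show "(hnorm H (X m - X n))\<^sup>2 < e\<^sup>2"
        by linarith
    qed (use \<open>0 < e\<close> in simp)
    then show ?thesis by blast
  qed
  from complete[OF XV this] obtain p
    where p: "p \<in> vectors H" "(\<lambda>n. hnorm H (X n - p)) \<longlonglongrightarrow> 0"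
    by (rule bexE)
  show ?thesis
  proof (rule bexI[of _ p], intro conjI ballI allI impI)
    show "\<exists>s\<in>S. hnorm H (p - s) < e" if "0 < e" for e :: real
    proof -
      have "\<forall>\<^sub>F n in sequentially. hnorm H (X n - p) < e"
        using order_tendstoD(2)[OF p(2) that] .
      then obtain n where "hnorm H (X n - p) < e"
        by (auto dest: eventually_happens)
      with X(1) XV p(1) show ?thesis
        by (metis hnorm_commute)
    qed
    fix s assume s: "s \<in> S"
    then have sV: "s \<in> vectors H" using sub by auto
    \<comment> \<open>Moving from \<open>X n\<close> along s stays in S, so the squared distance to
      h never drops below d, while \<open>X n\<close> exceeds d by less than 1/(n+1).\<close>
    have "(cmod (ip H (h - X n) s))\<^sup>2 \<le> (1 / real (Suc n)) * (hnorm H s)\<^sup>2" for n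
    proof -
      have "d \<le> (hnorm H (\<lambda>i. 1 * (h - X n) i + t * s i))\<^sup>2" for t
      proof -
        have "(\<lambda>i. 1 * (h - X n) i + t * s i) = h - (\<lambda>i. 1 * X n i + (- t) * s i)"
          by (simp add: fun_eq_iff)
        then show ?thesis
          using d_le[OF lin[OF X(1) s]] by metis
      qed
      from ip_le_of_minimal[OF diff_mem[OF h XV] sV this]
      have "(cmod (ip H (h - X n) s))\<^sup>2 \<le> ((hnorm H (h - X n))\<^sup>2 - d) * (hnorm H s)\<^sup>2" .
      also have "\<dots> \<le> (1 / real (Suc n)) * (hnorm H s)\<^sup>2"
        using X(2)[of n] by (intro mult_right_mono) auto
      finally show ?thesis .
    qed
    then have "\<forall>n. norm ((cmod (ip H (h - X n) s))\<^sup>2) \<le> 1 / real (Suc n) * (hnorm H s)\<^sup>2"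
      by simp
    then have "(\<lambda>n. (cmod (ip H (h - X n) s))\<^sup>2) \<longlonglongrightarrow> 0"
      by (rule Lim_null_comparison[OF always_eventually
            tendsto_mult_left_zero[OF LIMSEQ_Suc[OF lim_1_over_n]]])
    moreover have "(\<lambda>n. (cmod (ip H (h - X n) s))\<^sup>2) \<longlonglongrightarrow> (cmod (ip H (h - p) s))\<^sup>2"
    proof -
      have "(\<lambda>n. ip H h s - ip H (X n) s) \<longlonglongrightarrow> ip H h s - ip H p s"
        by (intro tendsto_intros tendsto_ip_left sV XV p)
      then have "(\<lambda>n. ip H (h - X n) s) \<longlonglongrightarrow> ip H (h - p) s"
        by (simp only: ip_diff_left[OF sV h XV] ip_diff_left[OF sV h p(1)])
      then show ?thesis
        by (intro tendsto_intros)
    qed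
    ultimately have "(cmod (ip H (h - p) s))\<^sup>2 = 0"
      by (rule LIMSEQ_unique[symmetric])
    then show "ip H (h - p) s = 0"
      by simp
  qed (rule p)
qed

text \<open>Projecting f leaves a remainder orthogonal to S, which is null by \<open>orth\<close>.
  This is the density criterion behind every \<open>densely_defined\<close> claim below.\<close>

lemma approx_of_orthogonal_trivial:
  assumes "S \<subseteq> vectors H" "(\<lambda>_. 0) \<in> S"
    and "\<And>f g a b. \<lbrakk>f \<in> S; g \<in> S\<rbrakk> \<Longrightarrow> (\<lambda>i. a * f i + b * g i) \<in> S"
    and orth: "\<And>h. \<lbrakk>h \<in> vectors H; \<And>s. s \<in> S \<Longrightarrow> ip H h s = 0\<rbrakk> \<Longrightarrow> hnorm H h = 0"
    and f: "f \<in> vectors H" and "0 < e"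
  shows "\<exists>s\<in>S. hnorm H (f - s) < e"
proof -
  obtain p where p: "p \<in> vectors H" "\<And>e. 0 < e \<Longrightarrow> \<exists>s\<in>S. hnorm H (p - s) < e"
    "\<And>s. s \<in> S \<Longrightarrow> ip H (f - p) s = 0"
    using exists_projection[OF assms(1-3) f] by blast
  obtain s where s: "s \<in> S" "hnorm H (p - s) < e"
    using p(2)[OF \<open>0 < e\<close>] by blast
  have "hnorm H (f - p) = 0"
    by (rule orth[OF diff_mem[OF f p(1)] p(3)])
  with s hnorm_triangle[OF f p(1), of s] assms(1) show ?thesis
    by force
qed

text \<open>Orthogonality gives |u|^2 = <u, u - s> for all s in S, which contradicts Cauchy-Schwarz
  once s is closer to u than the norm of u.\<close>

lemma hnorm_eq_zero_of_dense:
  assumes u: "u \<in> vectors H" and "S \<subseteq> vectors H"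
    and dense: "\<And>e. 0 < e \<Longrightarrow> \<exists>s\<in>S. hnorm H (u - s) < e"
    and orth: "\<And>s. s \<in> S \<Longrightarrow> ip H u s = 0"
  shows "hnorm H u = 0"
proof (rule ccontr)
  assume "hnorm H u \<noteq> 0"
  with hnorm_nonneg[OF u] have pos: "0 < hnorm H u" by simp
  then obtain s where s: "s \<in> S" "hnorm H (u - s) < hnorm H u"
    using dense by blast
  then have sV: "s \<in> vectors H" using assms(2) by auto
  have "(hnorm H u)\<^sup>2 = cmod (ip H u (u - s))"
    using orth[OF s(1)] by (simp add: ip_diff_right u sV ip_self norm_power)
  also have "\<dots> \<le> hnorm H u * hnorm H (u - s)"
    by (intro Cauchy_Schwarz u diff_mem sV)
  also have "\<dots> < hnorm H u * hnorm H u"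
    using s(2) pos by simp
  finally show False by (simp add: power2_eq_square)
qed

end

section \<open>Direct sums and adjoints\<close>

text \<open>Pairs are encoded as functions on the sum type, so that a graph becomes a subspace of a
  single \<open>hilbert\<close> record and \<open>exists_projection\<close> applies to it.\<close>

definition hilbert_sum :: "'i hilbert \<Rightarrow> 'j hilbert \<Rightarrow> ('i + 'j) hilbert" where
  "hilbert_sum H\<^sub>1 H\<^sub>2 =
     \<lparr> vectors = {f. (\<lambda>i. f (Inl i)) \<in> vectors H\<^sub>1 \<and> (\<lambda>j. f (Inr j)) \<in> vectors H\<^sub>2},
       ip = (\<lambda>f g. ip H\<^sub>1 (\<lambda>i. f (Inl i)) (\<lambda>i. g (Inl i))
                 + ip H\<^sub>2 (\<lambda>j. f (Inr j)) (\<lambda>j. g (Inr j))) \<rparr>"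

lemma hnorm_hilbert_sum:
  assumes "hilbert_space H\<^sub>1" "hilbert_space H\<^sub>2" "f \<in> vectors (hilbert_sum H\<^sub>1 H\<^sub>2)"
  shows "hnorm (hilbert_sum H\<^sub>1 H\<^sub>2) f
    = sqrt ((hnorm H\<^sub>1 (\<lambda>i. f (Inl i)))\<^sup>2 + (hnorm H\<^sub>2 (\<lambda>j. f (Inr j)))\<^sup>2)"
  using assms by (simp add: hnorm_def hilbert_sum_def hilbert_space.ip_nonneg)

lemma hilbert_space_hilbert_sum:
  assumes H1: "hilbert_space H\<^sub>1" and H2: "hilbert_space H\<^sub>2"
  shows "hilbert_space (hilbert_sum H\<^sub>1 H\<^sub>2)"
proof
  interpret H1: hilbert_space H\<^sub>1 by (fact H1)
  interpret H2: hilbert_space H\<^sub>2 by (fact H2)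
  let ?H = "hilbert_sum H\<^sub>1 H\<^sub>2"
  show "(\<lambda>_. 0) \<in> vectors ?H"
    by (simp add: hilbert_sum_def H1.zero_mem H2.zero_mem)
  fix f g h :: "'a + 'b \<Rightarrow> complex" and a b
  assume f: "f \<in> vectors ?H"
  show "0 \<le> Re (ip ?H f f)"
    using f by (simp add: hilbert_sum_def H1.ip_nonneg H2.ip_nonneg)
  assume g: "g \<in> vectors ?H"
  show lin: "(\<lambda>i. a * f i + b * g i) \<in> vectors ?H"
    using f g by (simp add: hilbert_sum_def H1.lincomb_mem H2.lincomb_mem)
  show "ip ?H g f = cnj (ip ?H f g)"
    using f g
    by (simp add: hilbert_sum_def H1.ip_commute[of "\<lambda>i. f (Inl i)" "\<lambda>i. g (Inl i)"]
        H2.ip_commute[of "\<lambda>i. f (Inr i)" "\<lambda>i. g (Inr i)"])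
  assume h: "h \<in> vectors ?H"
  show "ip ?H h (\<lambda>i. a * f i + b * g i) = a * ip ?H h f + b * ip ?H h g"
    using f g h by (simp add: hilbert_sum_def H1.ip_lincomb_right H2.ip_lincomb_right algebra_simps)
next
  interpret H1: hilbert_space H\<^sub>1 by (fact H1)
  interpret H2: hilbert_space H\<^sub>2 by (fact H2)
  let ?H = "hilbert_sum H\<^sub>1 H\<^sub>2"
  fix X :: "nat \<Rightarrow> 'a + 'b \<Rightarrow> complex"
  assume X: "\<And>n. X n \<in> vectors ?H"
    and cau: "\<And>e. 0 < e \<Longrightarrow> \<exists>N. \<forall>m\<ge>N. \<forall>n\<ge>N. hnorm ?H (X m - X n) < e"
  let ?L = "\<lambda>n i. X n (Inl i)" and ?R = "\<lambda>n i. X n (Inr i)"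
  have L: "?L n \<in> vectors H\<^sub>1" and R: "?R n \<in> vectors H\<^sub>2" for n
    using X[of n] by (auto simp: hilbert_sum_def)
  have diff: "f - g \<in> vectors ?H" if "f \<in> vectors ?H" "g \<in> vectors ?H" for f g
    using that H1.diff_mem H2.diff_mem by (simp add: hilbert_sum_def fun_diff_def)
  have norm: "hnorm ?H (f - g) = sqrt ((hnorm H\<^sub>1 ((\<lambda>i. f (Inl i)) - (\<lambda>i. g (Inl i))))\<^sup>2
      + (hnorm H\<^sub>2 ((\<lambda>i. f (Inr i)) - (\<lambda>i. g (Inr i))))\<^sup>2)"
    if "f \<in> vectors ?H" "g \<in> vectors ?H" for f g
    using hnorm_hilbert_sum[OF H1 H2 diff[OF that]] by (simp add: fun_diff_def)
  have "hnorm H\<^sub>1 (?L m - ?L n) \<le> hnorm ?H (X m - X n)"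
    "hnorm H\<^sub>2 (?R m - ?R n) \<le> hnorm ?H (X m - X n)" for m n
    by (simp_all add: norm X real_le_rsqrt)
  then have "\<exists>N. \<forall>m\<ge>N. \<forall>n\<ge>N. hnorm H\<^sub>1 (?L m - ?L n) < e"
    "\<exists>N. \<forall>m\<ge>N. \<forall>n\<ge>N. hnorm H\<^sub>2 (?R m - ?R n) < e" if "0 < e" for e
    using cau[OF that] by (meson le_less_trans)+
  with H1.complete[of ?L, OF L] H2.complete[of ?R, OF R] obtain l r
    where l: "l \<in> vectors H\<^sub>1" "(\<lambda>n. hnorm H\<^sub>1 (?L n - l)) \<longlonglongrightarrow> 0"
      and r: "r \<in> vectors H\<^sub>2" "(\<lambda>n. hnorm H\<^sub>2 (?R n - r)) \<longlonglongrightarrow> 0"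
    by metis
  let ?l = "case_sum l r"
  have mem: "?l \<in> vectors ?H"
    using l(1) r(1) by (simp add: hilbert_sum_def)
  have "(\<lambda>n. sqrt ((hnorm H\<^sub>1 (?L n - l))\<^sup>2 + (hnorm H\<^sub>2 (?R n - r))\<^sup>2)) \<longlonglongrightarrow> sqrt (0\<^sup>2 + 0\<^sup>2)"
    by (intro tendsto_intros l r)
  then have "(\<lambda>n. hnorm ?H (X n - ?l)) \<longlonglongrightarrow> 0"
    by (simp add: norm X mem)
  with mem show "\<exists>l\<in>vectors ?H. (\<lambda>n. hnorm ?H (X n - l)) \<longlonglongrightarrow> 0"
    by blast
qed


lemma mem_adjoint_op_iff: "(g, f) \<in> adjoint_op H\<^sub>1 H\<^sub>2 T \<longleftrightarrow> g \<in> vectors H\<^sub>2 \<and> f \<in> vectors H\<^sub>1 \<and>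
    (\<forall>p q. (p, q) \<in> T \<longrightarrow> ip H\<^sub>2 g q = ip H\<^sub>1 f p)"
  by (auto simp: adjoint_op_def)

lemma adjoint_op_subspace:
  assumes "hilbert_space H\<^sub>1" "hilbert_space H\<^sub>2" "T \<subseteq> vectors H\<^sub>1 \<times> vectors H\<^sub>2"
  shows adjoint_op_zero: "((\<lambda>_. 0), (\<lambda>_. 0)) \<in> adjoint_op H\<^sub>1 H\<^sub>2 T"
    and adjoint_op_lincomb:
      "\<lbrakk>(f, g) \<in> adjoint_op H\<^sub>1 H\<^sub>2 T; (f', g') \<in> adjoint_op H\<^sub>1 H\<^sub>2 T\<rbrakk>
        \<Longrightarrow> ((\<lambda>i. a * f i + b * f' i), (\<lambda>j. a * g j + b * g' j)) \<in> adjoint_op H\<^sub>1 H\<^sub>2 T"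
proof -
  interpret H1: hilbert_space H\<^sub>1 by (fact assms)
  interpret H2: hilbert_space H\<^sub>2 by (fact assms)
  have "p \<in> vectors H\<^sub>1" "q \<in> vectors H\<^sub>2" if "(p, q) \<in> T" for p q
    using that assms(3) by auto
  then show "((\<lambda>_. 0), (\<lambda>_. 0)) \<in> adjoint_op H\<^sub>1 H\<^sub>2 T"
    "\<lbrakk>(f, g) \<in> adjoint_op H\<^sub>1 H\<^sub>2 T; (f', g') \<in> adjoint_op H\<^sub>1 H\<^sub>2 T\<rbrakk>
        \<Longrightarrow> ((\<lambda>i. a * f i + b * f' i), (\<lambda>j. a * g j + b * g' j)) \<in> adjoint_op H\<^sub>1 H\<^sub>2 T"
    by (auto simp: mem_adjoint_op_iff H1.zero_mem H2.zero_mem H1.ip_zero_left H2.ip_zero_left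
        H1.lincomb_mem H2.lincomb_mem H1.ip_lincomb_left H2.ip_lincomb_left)
qed


section \<open>Closable operators and von Neumann's theorem\<close>

text \<open>Closability enters as density of the domain of the adjoint, which is the form in which
  it can be checked for the polynomial operator. Density of the domain of \<open>T\<^sub>0\<close>
  makes the adjoint single-valued.\<close>

locale closable_operator = H1: hilbert_space H\<^sub>1 + H2: hilbert_space H\<^sub>2
  for H\<^sub>1 :: "'i hilbert" and H\<^sub>2 :: "'j hilbert" +
  fixes T\<^sub>0 :: "(('i \<Rightarrow> complex) \<times> ('j \<Rightarrow> complex)) set"
  assumes graph: "T\<^sub>0 \<subseteq> vectors H\<^sub>1 \<times> vectors H\<^sub>2"
    and graph_zero: "((\<lambda>_. 0), (\<lambda>_. 0)) \<in> T\<^sub>0"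
    and graph_lincomb: "\<lbrakk>(f, g) \<in> T\<^sub>0; (f', g') \<in> T\<^sub>0\<rbrakk>
        \<Longrightarrow> ((\<lambda>i. a * f i + b * f' i), (\<lambda>j. a * g j + b * g' j)) \<in> T\<^sub>0"
    and domain_dense: "densely_defined H\<^sub>1 T\<^sub>0"
    and adjoint_dense: "densely_defined H\<^sub>2 (adjoint_op H\<^sub>1 H\<^sub>2 T\<^sub>0)"
begin

abbreviation T where "T \<equiv> closure_op H\<^sub>1 H\<^sub>2 T\<^sub>0"
abbreviation T_adj where "T_adj \<equiv> adjoint_op H\<^sub>1 H\<^sub>2 T"

lemma graphD: "(f, g) \<in> T\<^sub>0 \<Longrightarrow> f \<in> vectors H\<^sub>1" "(f, g) \<in> T\<^sub>0 \<Longrightarrow> g \<in> vectors H\<^sub>2"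
  using graph by auto

lemma T_iff: "(f, g) \<in> T \<longleftrightarrow> f \<in> vectors H\<^sub>1 \<and> g \<in> vectors H\<^sub>2 \<and>
    (\<forall>e>0. \<exists>f' g'. (f', g') \<in> T\<^sub>0 \<and> hnorm H\<^sub>1 (f - f') < e \<and> hnorm H\<^sub>2 (g - g') < e)"
  by (auto simp: closure_op_def Bex_def)

lemma T_D: "(f, g) \<in> T \<Longrightarrow> f \<in> vectors H\<^sub>1" "(f, g) \<in> T \<Longrightarrow> g \<in> vectors H\<^sub>2"
  by (simp_all add: T_iff)

lemma graph_subset_T: "T\<^sub>0 \<subseteq> T"
proof (rule subrelI)
  fix f g assume fg: "(f, g) \<in> T\<^sub>0"
  then have "hnorm H\<^sub>1 (f - f) = 0" "hnorm H\<^sub>2 (g - g) = 0"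
    using H1.hnorm_zero H2.hnorm_zero by (simp_all add: fun_diff_def)
  with fg graphD[OF fg] show "(f, g) \<in> T"
    unfolding T_iff by metis
qed

lemma T_lincomb:
  assumes "(f, g) \<in> T" "(f', g') \<in> T"
  shows "((\<lambda>i. a * f i + b * f' i), (\<lambda>j. a * g j + b * g' j)) \<in> T"
  unfolding T_iff
proof (intro conjI allI impI)
  note m = T_D[OF assms(1)] T_D[OF assms(2)]
  show "(\<lambda>i. a * f i + b * f' i) \<in> vectors H\<^sub>1" "(\<lambda>j. a * g j + b * g' j) \<in> vectors H\<^sub>2"
    using m by (simp_all add: H1.lincomb_mem H2.lincomb_mem)
  fix e :: real assume "0 < e"
  \<comment> \<open>The summand 1 keeps the denominator positive when a = b = 0 and makes the
    resulting estimate strict.\<close>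
  define d where "d = e / (cmod a + cmod b + 1)"
  have s: "0 < cmod a + cmod b + 1"
    by (simp add: add_nonneg_pos)
  with \<open>0 < e\<close> have "0 < d" by (simp add: d_def)
  have small: "cmod a * x + cmod b * y < e" if "x < d" "y < d" for x y
  proof -
    have "cmod a * x + cmod b * y \<le> cmod a * d + cmod b * d"
      using that by (intro add_mono mult_left_mono) auto
    also have "\<dots> < (cmod a + cmod b + 1) * d"
      using \<open>0 < d\<close> by (simp add: algebra_simps)
    also have "\<dots> = e"
      using s by (simp add: d_def)
    finally show ?thesis .
  qed
  obtain p q where pq: "(p, q) \<in> T\<^sub>0" "hnorm H\<^sub>1 (f - p) < d" "hnorm H\<^sub>2 (g - q) < d"
    using assms(1) \<open>0 < d\<close> unfolding T_iff by blast
  obtain p' q' where pq': "(p', q') \<in> T\<^sub>0" "hnorm H\<^sub>1 (f' - p') < d" "hnorm H\<^sub>2 (g' - q') < d"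
    using assms(2) \<open>0 < d\<close> unfolding T_iff by blast
  show "\<exists>u v. (u, v) \<in> T\<^sub>0 \<and> hnorm H\<^sub>1 ((\<lambda>i. a * f i + b * f' i) - u) < e
      \<and> hnorm H\<^sub>2 ((\<lambda>j. a * g j + b * g' j) - v) < e"
  proof (intro exI conjI)
    show "((\<lambda>i. a * p i + b * p' i), (\<lambda>j. a * q j + b * q' j)) \<in> T\<^sub>0"
      by (rule graph_lincomb[OF pq(1) pq'(1)])
    show "hnorm H\<^sub>1 ((\<lambda>i. a * f i + b * f' i) - (\<lambda>i. a * p i + b * p' i)) < e"
      by (rule le_less_trans[OF H1.hnorm_lincomb_diff small])
         (use m graphD[OF pq(1)] graphD[OF pq'(1)] pq pq' in auto)
    show "hnorm H\<^sub>2 ((\<lambda>j. a * g j + b * g' j) - (\<lambda>j. a * q j + b * q' j)) < e"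
      by (rule le_less_trans[OF H2.hnorm_lincomb_diff small])
         (use m graphD[OF pq(1)] graphD[OF pq'(1)] pq pq' in auto)
  qed
qed

text \<open>Both sides of the adjoint relation are continuous for the graph norm, so it passes from
  \<open>T\<^sub>0\<close> to its closure.\<close>

lemma T_adj_eq: "T_adj = adjoint_op H\<^sub>1 H\<^sub>2 T\<^sub>0"
proof
  show "T_adj \<subseteq> adjoint_op H\<^sub>1 H\<^sub>2 T\<^sub>0"
    using graph_subset_T by (auto simp: adjoint_op_def)
  show "adjoint_op H\<^sub>1 H\<^sub>2 T\<^sub>0 \<subseteq> T_adj"
  proof (rule subrelI)
    fix g f assume gf: "(g, f) \<in> adjoint_op H\<^sub>1 H\<^sub>2 T\<^sub>0"
    then have g: "g \<in> vectors H\<^sub>2" and f: "f \<in> vectors H\<^sub>1"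
      and adj: "\<And>p q. (p, q) \<in> T\<^sub>0 \<Longrightarrow> ip H\<^sub>2 g q = ip H\<^sub>1 f p"
      by (auto simp: adjoint_op_def)
    have "ip H\<^sub>2 g v = ip H\<^sub>1 f u" if uv: "(u, v) \<in> T" for u v
    proof (rule ccontr)
      let ?x = "ip H\<^sub>2 g v - ip H\<^sub>1 f u" and ?C = "hnorm H\<^sub>2 g + hnorm H\<^sub>1 f + 1"
      assume "ip H\<^sub>2 g v \<noteq> ip H\<^sub>1 f u"
      then have "0 < cmod ?x" by simp
      have C: "0 < ?C"
        using H1.hnorm_nonneg[OF f] H2.hnorm_nonneg[OF g] by simp
      \<comment> \<open>With this tolerance the Cauchy-Schwarz bound for the discrepancy
        \<open>?x\<close> falls strictly below its modulus.\<close>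
      define e where "e = cmod ?x / ?C"
      have e: "0 < e" using \<open>0 < cmod ?x\<close> C by (simp add: e_def)
      then obtain p q where pq: "(p, q) \<in> T\<^sub>0" "hnorm H\<^sub>1 (u - p) < e" "hnorm H\<^sub>2 (v - q) < e"
        using uv unfolding T_iff by blast
      note m = f g T_D[OF uv] graphD[OF pq(1)]
      have "?x = ip H\<^sub>2 g (v - q) - ip H\<^sub>1 f (u - p)"
        using m adj[OF pq(1)] by (simp add: H1.ip_diff_right H2.ip_diff_right)
      then have "cmod ?x \<le> cmod (ip H\<^sub>2 g (v - q)) + cmod (ip H\<^sub>1 f (u - p))"
        by (simp add: norm_triangle_ineq4)
      also have "\<dots> \<le> hnorm H\<^sub>2 g * hnorm H\<^sub>2 (v - q) + hnorm H\<^sub>1 f * hnorm H\<^sub>1 (u - p)"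
        using m by (intro add_mono H1.Cauchy_Schwarz H2.Cauchy_Schwarz H1.diff_mem H2.diff_mem)
      also have "\<dots> \<le> hnorm H\<^sub>2 g * e + hnorm H\<^sub>1 f * e"
        using m pq by (intro add_mono mult_left_mono H1.hnorm_nonneg H2.hnorm_nonneg) auto
      also have "\<dots> < ?C * e"
        using e by (simp add: algebra_simps)
      also have "\<dots> = cmod ?x"
        using C by (simp add: e_def)
      finally show False by simp
    qed
    with f g show "(g, f) \<in> T_adj"
      by (auto simp: adjoint_op_def)
  qed
qed

lemma T_adj_iff: "(g, f) \<in> T_adj \<longleftrightarrow> g \<in> vectors H\<^sub>2 \<and> f \<in> vectors H\<^sub>1 \<and>
    (\<forall>p q. (p, q) \<in> T\<^sub>0 \<longrightarrow> ip H\<^sub>2 g q = ip H\<^sub>1 f p)"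
  unfolding T_adj_eq mem_adjoint_op_iff ..

lemma T_adj_D:
  assumes "(g, f) \<in> T_adj"
  shows "g \<in> vectors H\<^sub>2" "f \<in> vectors H\<^sub>1" "(p, q) \<in> T \<Longrightarrow> ip H\<^sub>2 g q = ip H\<^sub>1 f p"
  using assms by (auto simp: adjoint_op_def)

lemma T_adj_lincomb:
  assumes "(f, g) \<in> T_adj" "(f', g') \<in> T_adj"
  shows "((\<lambda>i. a * f i + b * f' i), (\<lambda>j. a * g j + b * g' j)) \<in> T_adj"
  using assms unfolding T_adj_eq
  by (rule adjoint_op_lincomb[OF H1.hilbert_space_axioms H2.hilbert_space_axioms graph])

text \<open>The adjoint relation moves g - g' over to the null vector f - f', so g - g' is
  orthogonal to the dense domain of the adjoint.\<close>

lemma T_single_valued: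
  assumes "(f, g) \<in> T" "(f', g') \<in> T" "hnorm H\<^sub>1 (f - f') = 0"
  shows "hnorm H\<^sub>2 (g - g') = 0"
proof (rule H2.hnorm_eq_zero_of_dense[where S = "Domain T_adj"])
  note m = T_D[OF assms(1)] T_D[OF assms(2)]
  show "g - g' \<in> vectors H\<^sub>2"
    using m by (simp add: H2.diff_mem)
  then show "\<exists>s\<in>Domain T_adj. hnorm H\<^sub>2 (g - g' - s) < e" if "0 < e" for e
    using adjoint_dense that unfolding T_adj_eq densely_defined_def by blast
  show "Domain T_adj \<subseteq> vectors H\<^sub>2"
    by (auto simp: T_adj_iff)
  fix s assume "s \<in> Domain T_adj"
  then obtain c where c: "(s, c) \<in> T_adj" by blast
  note d = T_adj_D(1,2)[OF c]
  have "ip H\<^sub>2 s (g - g') = ip H\<^sub>1 c (f - f')"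
    using m d T_adj_D(3)[OF c assms(1)] T_adj_D(3)[OF c assms(2)]
    by (simp add: H1.ip_diff_right H2.ip_diff_right)
  also have "\<dots> = 0"
    using H1.ip_commute[of "f - f'" c] H1.ip_zero_of_hnorm[of "f - f'" c] m d assms(3)
    by (simp add: H1.diff_mem)
  finally show "ip H\<^sub>2 (g - g') s = 0"
    using H2.ip_commute[of s "g - g'"] m d by (simp add: H2.diff_mem)
qed

text \<open>Mirror image of \<open>T_single_valued\<close>, tested against the dense domain of
  \<open>T\<^sub>0\<close>.\<close>

lemma T_adj_single_valued:
  assumes "(g, f) \<in> T_adj" "(g', f') \<in> T_adj" "hnorm H\<^sub>2 (g - g') = 0"
  shows "hnorm H\<^sub>1 (f - f') = 0"
proof (rule H1.hnorm_eq_zero_of_dense[where S = "Domain T\<^sub>0"])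
  note m = T_adj_D(1,2)[OF assms(1)] T_adj_D(1,2)[OF assms(2)]
  show "f - f' \<in> vectors H\<^sub>1"
    using m by (simp add: H1.diff_mem)
  then show "\<exists>s\<in>Domain T\<^sub>0. hnorm H\<^sub>1 (f - f' - s) < e" if "0 < e" for e
    using domain_dense that unfolding densely_defined_def by blast
  show "Domain T\<^sub>0 \<subseteq> vectors H\<^sub>1"
    using graph by auto
  fix s assume "s \<in> Domain T\<^sub>0"
  then obtain q where q: "(s, q) \<in> T\<^sub>0" by blast
  then have "(s, q) \<in> T" using graph_subset_T by auto
  have "ip H\<^sub>1 (f - f') s = ip H\<^sub>2 (g - g') q"
    using m graphD[OF q] T_adj_D(3)[OF assms(1) \<open>(s, q) \<in> T\<close>] T_adj_D(3)[OF assms(2) \<open>(s, q) \<in> T\<close>]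
    by (simp add: H1.ip_diff_left H2.ip_diff_left)
  also have "\<dots> = 0"
    using H2.ip_zero_of_hnorm[of "g - g'" q] m graphD[OF q] assms(3)
    by (simp add: H2.diff_mem)
  finally show "ip H\<^sub>1 (f - f') s = 0" .
qed

lemma linear_operator_T: "linear_operator H\<^sub>1 H\<^sub>2 T"
  unfolding linear_operator_def
proof (intro conjI)
  show "T \<subseteq> vectors H\<^sub>1 \<times> vectors H\<^sub>2"
    using T_D by auto
  show "((\<lambda>_. 0), (\<lambda>_. 0)) \<in> T"
    using graph_zero graph_subset_T by auto
qed (use T_lincomb T_single_valued in fast)+

section \<open>Resolvent, symmetry and self-adjointness of the composition\<close>

abbreviation K where "K \<equiv> T_adj O T"

text \<open>Project \<open>(0, h)\<close> onto the closed graph of \<open>T\<close>: the orthogonal part is \<open>(-T\<^sup>*\<phi>, \<phi>)\<close>.\<close>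

lemma exists_resolvent:
  assumes h: "h \<in> vectors H\<^sub>2"
  obtains \<phi> where "(\<phi>, h - \<phi>) \<in> K"
proof -
  interpret S: hilbert_space "hilbert_sum H\<^sub>1 H\<^sub>2"
    by (intro hilbert_space_hilbert_sum H1.hilbert_space_axioms H2.hilbert_space_axioms)
  let ?H = "hilbert_sum H\<^sub>1 H\<^sub>2"
  \<comment> \<open>Only the graph of \<open>T\<^sub>0\<close> is used; its closure in the direct
    sum corresponds to the graph of \<open>T\<close>.\<close>
  define G where "G = (\<lambda>(f, g). case_sum f g) ` T\<^sub>0"
  have mem: "case_sum f g \<in> vectors ?H \<longleftrightarrow> f \<in> vectors H\<^sub>1 \<and> g \<in> vectors H\<^sub>2" for f g
    by (simp add: hilbert_sum_def)
  have ip: "ip ?H (case_sum f g) (case_sum f' g') = ip H\<^sub>1 f f' + ip H\<^sub>2 g g'" for f g f' g'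
    by (simp add: hilbert_sum_def)
  have diff: "case_sum f g - case_sum f' g' = case_sum (f - f') (g - g')"
    for f f' :: "'i \<Rightarrow> complex" and g g' :: "'j \<Rightarrow> complex"
    by (simp add: fun_eq_iff split: sum.split)
  have comb: "(\<lambda>i. a * case_sum f g i + b * case_sum f' g' i)
      = case_sum (\<lambda>i. a * f i + b * f' i) (\<lambda>j. a * g j + b * g' j)"
    for a b and f f' :: "'i \<Rightarrow> complex" and g g' :: "'j \<Rightarrow> complex"
    by (simp add: fun_eq_iff split: sum.split)
  have G_sub: "G \<subseteq> vectors ?H"
    using graphD by (auto simp: G_def mem)
  have G_zero: "(\<lambda>_. 0) \<in> G"
  proof -
    have "(\<lambda>_. 0) = case_sum (\<lambda>_::'i. 0::complex) (\<lambda>_::'j. 0)"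
      by (simp add: fun_eq_iff split: sum.split)
    then show ?thesis
      unfolding G_def using graph_zero by (force simp: image_iff)
  qed
  have G_lincomb: "(\<lambda>i. a * f i + b * g i) \<in> G" if fg: "f \<in> G" "g \<in> G" for a b f g
  proof -
    obtain u v u' v' where uv: "(u, v) \<in> T\<^sub>0" "f = case_sum u v"
      and uv': "(u', v') \<in> T\<^sub>0" "g = case_sum u' v'"
      using fg by (auto simp: G_def)
    show ?thesis
      unfolding G_def
      by (rule image_eqI[OF _ graph_lincomb[OF uv(1) uv'(1), of a b]]) (simp add: uv(2) uv'(2) comb)
  qed
  have h_mem: "case_sum (\<lambda>_. 0) h \<in> vectors ?H"
    using h by (simp add: mem H1.zero_mem)
  obtain p where p: "p \<in> vectors ?H" "\<And>e. 0 < e \<Longrightarrow> \<exists>s\<in>G. hnorm ?H (p - s) < e"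
    "\<And>s. s \<in> G \<Longrightarrow> ip ?H (case_sum (\<lambda>_. 0) h - p) s = 0"
    using S.exists_projection[OF G_sub G_zero G_lincomb h_mem] by blast
  obtain c \<psi> where pc: "p = case_sum c \<psi>"
    using surjective_sum[of p] by metis
  have c: "c \<in> vectors H\<^sub>1" and \<psi>: "\<psi> \<in> vectors H\<^sub>2"
    using p(1) by (simp_all add: pc mem)
  have "(c, \<psi>) \<in> T"
    unfolding T_iff
  proof (intro conjI allI impI c \<psi>)
    fix e :: real assume "0 < e"
    then obtain u v where uv: "(u, v) \<in> T\<^sub>0" "hnorm ?H (p - case_sum u v) < e"
      using p(2)[of e] by (auto simp: G_def)
    have "hnorm ?H (p - case_sum u v) = sqrt ((hnorm H\<^sub>1 (c - u))\<^sup>2 + (hnorm H\<^sub>2 (\<psi> - v))\<^sup>2)"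
      using c \<psi> graphD[OF uv(1)]
      unfolding pc diff
      by (subst hnorm_hilbert_sum)
         (simp_all only: mem H1.hilbert_space_axioms H2.hilbert_space_axioms
           H1.diff_mem H2.diff_mem sum.case simp_thms)
    then have "hnorm H\<^sub>1 (c - u) \<le> hnorm ?H (p - case_sum u v)"
      "hnorm H\<^sub>2 (\<psi> - v) \<le> hnorm ?H (p - case_sum u v)"
      by (simp_all add: real_le_rsqrt)
    with uv show "\<exists>u v. (u, v) \<in> T\<^sub>0 \<and> hnorm H\<^sub>1 (c - u) < e \<and> hnorm H\<^sub>2 (\<psi> - v) < e"
      by (meson le_less_trans)
  qed
  \<comment> \<open>The remainder of the projection is (-c, h - \<psi>), and its orthogonality to
    the pairs (u, v) in \<open>T\<^sub>0\<close> is precisely the adjoint relation.\<close>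
  moreover have "(h - \<psi>, c) \<in> T_adj"
    unfolding T_adj_iff
  proof (intro conjI allI impI c H2.diff_mem h \<psi>)
    fix u v assume uv: "(u, v) \<in> T\<^sub>0"
    then have "case_sum u v \<in> G" by (force simp: G_def image_iff)
    from p(3)[OF this] have "ip H\<^sub>1 ((\<lambda>_. 0) - c) u + ip H\<^sub>2 (h - \<psi>) v = 0"
      unfolding pc diff ip .
    moreover have "ip H\<^sub>1 ((\<lambda>_. 0) - c) u = - ip H\<^sub>1 c u"
      using H1.ip_lincomb_left[of u c c "-1" 0] c graphD[OF uv] by (simp add: fun_diff_def)
    ultimately show "ip H\<^sub>2 (h - \<psi>) v = ip H\<^sub>1 c u"
      by simp
  qed
  \<comment> \<open>The required vector is h - \<psi>: the adjoint sends it to c, and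
    \<open>T\<close> sends c to \<psi>.\<close>
  ultimately have "(h - \<psi>, h - (h - \<psi>)) \<in> K"
    by (auto simp: fun_diff_def)
  then show thesis by (rule that)
qed

text \<open>The last equation is the positivity of \<open>K\<close>: <\<phi>, K \<phi>> is the
  squared norm of the adjoint applied to \<phi>.\<close>

lemma K_D:
  assumes "(\<phi>, \<psi>) \<in> K"
  obtains c where "(\<phi>, c) \<in> T_adj" "(c, \<psi>) \<in> T" "\<phi> \<in> vectors H\<^sub>2" "\<psi> \<in> vectors H\<^sub>2" "c \<in> vectors H\<^sub>1"
    "ip H\<^sub>2 \<phi> \<psi> = ip H\<^sub>1 c c"
proof -
  obtain c where c: "(\<phi>, c) \<in> T_adj" "(c, \<psi>) \<in> T"
    using assms by auto
  with T_adj_D[OF c(1)] T_D[OF c(2)] show thesis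
    by (intro that) auto
qed

lemma K_lincomb:
  assumes "(f, g) \<in> K" "(f', g') \<in> K"
  shows "((\<lambda>i. a * f i + b * f' i), (\<lambda>j. a * g j + b * g' j)) \<in> K"
  using assms T_lincomb T_adj_lincomb by (auto intro!: relcompI)

lemma linear_operator_K: "linear_operator H\<^sub>2 H\<^sub>2 K"
  unfolding linear_operator_def
proof (intro conjI)
  show "K \<subseteq> vectors H\<^sub>2 \<times> vectors H\<^sub>2"
    using T_D T_adj_D by auto
  have "((\<lambda>_. 0), (\<lambda>_. 0)) \<in> T_adj"
    unfolding T_adj_eq
    by (rule adjoint_op_zero[OF H1.hilbert_space_axioms H2.hilbert_space_axioms graph])
  then show "((\<lambda>_. 0), (\<lambda>_. 0)) \<in> K"
    using graph_zero graph_subset_T by blast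
qed (use K_lincomb T_single_valued T_adj_single_valued in fast)+

lemma K_mem: "(\<phi>, \<psi>) \<in> K \<Longrightarrow> \<phi> \<in> vectors H\<^sub>2" "(\<phi>, \<psi>) \<in> K \<Longrightarrow> \<psi> \<in> vectors H\<^sub>2"
  by (erule K_D, assumption)+

text \<open>Both sides equal the inner product of the intermediate vectors c and c'.\<close>

lemma K_symmetric:
  assumes "(f, g) \<in> K" "(f', g') \<in> K"
  shows "ip H\<^sub>2 f g' = ip H\<^sub>2 g f'"
proof -
  obtain c where c: "(f, c) \<in> T_adj" "(c, g) \<in> T" using assms(1) by auto
  obtain c' where c': "(f', c') \<in> T_adj" "(c', g') \<in> T" using assms(2) by auto
  have "ip H\<^sub>2 f g' = ip H\<^sub>1 c c'"
    by (rule T_adj_D(3)[OF c(1) c'(2)])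
  also have "\<dots> = cnj (ip H\<^sub>2 f' g)"
    using H1.ip_commute[of c' c] T_D[OF c(2)] T_D[OF c'(2)] T_adj_D(3)[OF c'(1) c(2)] by simp
  also have "\<dots> = ip H\<^sub>2 g f'"
    using H2.ip_commute[of f' g] T_D[OF c(2)] T_adj_D(1)[OF c'(1)] by simp
  finally show ?thesis .
qed

text \<open>Let h be orthogonal to the domain and solve \<phi> + K \<phi> = h. Pairing with \<phi>
  makes |\<phi>|^2 + |c|^2 vanish, where c is the adjoint applied to \<phi>. Hence \<phi> and c are
  null, then so is T c, and with it h = \<phi> + T c.\<close>

lemma densely_defined_K: "densely_defined H\<^sub>2 K"
  unfolding densely_defined_def
proof (intro ballI allI impI)
  fix f e assume f: "f \<in> vectors H\<^sub>2" and e: "0 < (e::real)"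
  show "\<exists>g\<in>Domain K. hnorm H\<^sub>2 (f - g) < e"
  proof (rule H2.approx_of_orthogonal_trivial[OF _ _ _ _ f e])
    show "Domain K \<subseteq> vectors H\<^sub>2"
      using T_adj_D by auto
    show "(\<lambda>_. 0) \<in> Domain K"
      using linear_operator_K by (auto simp: linear_operator_def)
    show "(\<lambda>i. a * f i + b * g i) \<in> Domain K" if "f \<in> Domain K" "g \<in> Domain K" for f g a b
      using that K_lincomb by (meson Domain_iff)
    fix h assume h: "h \<in> vectors H\<^sub>2" and orth: "\<And>s. s \<in> Domain K \<Longrightarrow> ip H\<^sub>2 h s = 0"
    obtain \<phi> where \<phi>: "(\<phi>, h - \<phi>) \<in> K"
      using exists_resolvent[OF h] .
    then obtain c where c: "(\<phi>, c) \<in> T_adj" "(c, h - \<phi>) \<in> T" "\<phi> \<in> vectors H\<^sub>2" "c \<in> vectors H\<^sub>1"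
      "ip H\<^sub>2 \<phi> (h - \<phi>) = ip H\<^sub>1 c c"
      by (rule K_D)
    have "ip H\<^sub>2 \<phi> h = 0"
      using orth[of \<phi>] \<phi> H2.ip_commute[of h \<phi>] h c(3) by auto
    with c(5) have "Re (ip H\<^sub>2 \<phi> \<phi>) + Re (ip H\<^sub>1 c c) = 0"
      using h c(3) by (simp add: H2.ip_diff_right complex_eq_iff)
    then have "(hnorm H\<^sub>2 \<phi>)\<^sup>2 + (hnorm H\<^sub>1 c)\<^sup>2 = 0"
      using c by (simp add: H1.hnorm_square H2.hnorm_square)
    then have z: "hnorm H\<^sub>2 \<phi> = 0" "hnorm H\<^sub>1 c = 0"
      by (simp_all add: add_nonneg_eq_0_iff)
    have "hnorm H\<^sub>2 ((h - \<phi>) - (\<lambda>_. 0)) = 0"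
      using T_single_valued[OF c(2), of "\<lambda>_. 0" "\<lambda>_. 0"] graph_zero graph_subset_T z
      by (auto simp: fun_diff_def)
    with z H2.hnorm_lincomb[of "h - \<phi>" \<phi> 1 1] c(3) h have "hnorm H\<^sub>2 h \<le> 0"
      using H2.diff_mem[OF h c(3)] by (simp add: fun_diff_def)
    with H2.hnorm_nonneg[OF h] show "hnorm H\<^sub>2 h = 0"
      by simp
  qed
qed

text \<open>\<open>self_adjoint\<close> demands equality of graphs as sets of functions, so
  \<open>K\<close> has to contain all representatives of its vectors. The adjoint depends only on
  inner products and the closure only on distances, and both ignore null vectors.\<close>

lemma K_saturated:
  assumes K: "(\<phi>, \<psi>) \<in> K" and m: "\<phi>' \<in> vectors H\<^sub>2" "\<psi>' \<in> vectors H\<^sub>2"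
    and eq: "hnorm H\<^sub>2 (\<phi>' - \<phi>) = 0" "hnorm H\<^sub>2 (\<psi>' - \<psi>) = 0"
  shows "(\<phi>', \<psi>') \<in> K"
proof -
  obtain c where c: "(\<phi>, c) \<in> T_adj" "(c, \<psi>) \<in> T"
    using K by auto
  note n = T_adj_D(1,2)[OF c(1)] T_D[OF c(2)]
  have "ip H\<^sub>2 \<phi>' q = ip H\<^sub>2 \<phi> q" if "q \<in> vectors H\<^sub>2" for q
    using H2.ip_zero_of_hnorm[OF H2.diff_mem that eq(1)] m n that by (simp add: H2.ip_diff_left)
  with c(1) m have "(\<phi>', c) \<in> T_adj"
    using graphD by (simp add: T_adj_iff)
  moreover have "hnorm H\<^sub>2 (\<psi>' - q) \<le> hnorm H\<^sub>2 (\<psi> - q)" if "q \<in> vectors H\<^sub>2" for q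
    using H2.hnorm_triangle[of \<psi>' \<psi> q] eq(2) m n that by simp
  then have "(c, \<psi>') \<in> T"
    using c(2) m graphD(2) unfolding T_iff by (meson le_less_trans)
  ultimately show ?thesis by blast
qed

text \<open>Symmetry gives one inclusion. For (g, f) in the adjoint, solve \<phi> + K \<phi> = g +
  f. Then u = g - \<phi> is mapped by the adjoint to -u, so u is orthogonal to the range of I + K.
  This range is everything, so u is null.\<close>

lemma adjoint_K: "adjoint_op H\<^sub>2 H\<^sub>2 K = K"
proof
  show "K \<subseteq> adjoint_op H\<^sub>2 H\<^sub>2 K"
  proof (rule subrelI)
    fix f g assume fg: "(f, g) \<in> K"
    have "case x of (f', g') \<Rightarrow> ip H\<^sub>2 f g' = ip H\<^sub>2 g f'" if "x \<in> K" for x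
      using K_symmetric[OF fg, of "fst x" "snd x"] that by (simp add: split_beta)
    with K_mem[OF fg] show "(f, g) \<in> adjoint_op H\<^sub>2 H\<^sub>2 K"
      by (simp add: adjoint_op_def)
  qed
  show "adjoint_op H\<^sub>2 H\<^sub>2 K \<subseteq> K"
  proof (rule subrelI)
    fix g f assume "(g, f) \<in> adjoint_op H\<^sub>2 H\<^sub>2 K"
    then have g: "g \<in> vectors H\<^sub>2" and f: "f \<in> vectors H\<^sub>2"
      and adj: "\<And>p q. (p, q) \<in> K \<Longrightarrow> ip H\<^sub>2 g q = ip H\<^sub>2 f p"
      unfolding adjoint_op_def by blast+
    have "(\<lambda>i. 1 * g i + 1 * f i) \<in> vectors H\<^sub>2"
      by (intro H2.lincomb_mem g f)
    then obtain \<phi> where \<phi>: "(\<phi>, (\<lambda>i. 1 * g i + 1 * f i) - \<phi>) \<in> K"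
      by (rule exists_resolvent)
    let ?\<psi> = "(\<lambda>i. 1 * g i + 1 * f i) - \<phi>"
    let ?u = "g - \<phi>"
    have m: "\<phi> \<in> vectors H\<^sub>2" "?\<psi> \<in> vectors H\<^sub>2"
      using \<phi> by (rule K_mem)+
    have u: "?u \<in> vectors H\<^sub>2"
      by (intro H2.diff_mem g m)
    \<comment> \<open>Writing u itself as \<eta> + K \<eta> turns orthogonality to the range into
      <u, u> = 0.\<close>
    obtain \<eta> where \<eta>: "(\<eta>, ?u - \<eta>) \<in> K"
      using exists_resolvent[OF u] .
    then have n: "\<eta> \<in> vectors H\<^sub>2" "?u - \<eta> \<in> vectors H\<^sub>2"
      by (rule K_mem)+
    have fu: "f - ?\<psi> = (\<lambda>i. -1 * ?u i + 0 * ?u i)"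
      by (simp add: fun_eq_iff)
    have "ip H\<^sub>2 ?u (?u - \<eta>) = ip H\<^sub>2 (f - ?\<psi>) \<eta>"
      using adj[OF \<eta>] K_symmetric[OF \<phi> \<eta>] g f m n by (simp add: H2.ip_diff_left)
    also have "\<dots> = - ip H\<^sub>2 ?u \<eta>"
      unfolding fu by (simp only: H2.ip_lincomb_left[OF n(1) u u]) simp
    finally have "ip H\<^sub>2 ?u ?u = 0"
      using u n by (simp add: H2.ip_diff_right)
    then have u0: "hnorm H\<^sub>2 ?u = 0"
      by (simp add: H2.hnorm_zero_iff_ip u)
    moreover have "hnorm H\<^sub>2 (f - ?\<psi>) = 0"
      unfolding fu using H2.hnorm_scale[OF u, of "-1"] u0 by simp
    ultimately show "(g, f) \<in> K"
      by (intro K_saturated[OF \<phi> g f])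
  qed
qed

theorem self_adjoint_K: "self_adjoint H\<^sub>2 K"
  by (simp add: self_adjoint_def linear_operator_K densely_defined_K adjoint_K)

end

section \<open>The spaces \<open>L2 M\<close> and \<open>ell2 w\<close>\<close>

lemma mem_L2_iff: "f \<in> vectors (L2 M)
    \<longleftrightarrow> f \<in> borel_measurable M \<and> integrable M (\<lambda>x. (cmod (f x))\<^sup>2)"
  by (simp add: L2_def)

lemma hnorm_L2: "hnorm (L2 M) f = sqrt (\<integral>x. (cmod (f x))\<^sup>2 \<partial>M)"
proof -
  have "(\<lambda>x. cnj (f x) * f x) = (\<lambda>x. complex_of_real ((cmod (f x))\<^sup>2))"
    by (simp only: complex_norm_square mult.commute)
  then show ?thesis
    by (simp add: hnorm_def L2_def del: of_real_power)
qed

lemma hnorm_L2_square: "(hnorm (L2 M) f)\<^sup>2 = (\<integral>x. (cmod (f x))\<^sup>2 \<partial>M)"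
  by (simp add: hnorm_L2)

lemma nn_integral_L2:
  "f \<in> vectors (L2 M) \<Longrightarrow> (\<integral>\<^sup>+x. ennreal ((cmod (f x))\<^sup>2) \<partial>M) = ennreal ((hnorm (L2 M) f)\<^sup>2)"
  by (simp add: mem_L2_iff hnorm_L2_square nn_integral_eq_integral)

lemma mem_L2_of_nn_integral:
  assumes "f \<in> borel_measurable M" "(\<integral>\<^sup>+x. ennreal ((cmod (f x))\<^sup>2) \<partial>M) \<le> ennreal C" "0 \<le> C"
  shows "f \<in> vectors (L2 M)" "(hnorm (L2 M) f)\<^sup>2 \<le> C"
proof -
  have "integrable M (\<lambda>x. (cmod (f x))\<^sup>2)"
    using assms(1,2) by (intro integrableI_bounded) (auto simp: le_less_trans)
  with assms(1) show mem: "f \<in> vectors (L2 M)"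
    by (simp add: mem_L2_iff)
  show "(hnorm (L2 M) f)\<^sup>2 \<le> C"
    using assms(2,3) by (simp add: nn_integral_L2 mem)
qed

lemma integrable_L2_product:
  assumes "f \<in> vectors (L2 M)" "g \<in> vectors (L2 M)"
  shows "integrable M (\<lambda>x. cnj (f x) * g x)"
proof (rule Bochner_Integration.integrable_bound)
  show "integrable M (\<lambda>x. (cmod (f x))\<^sup>2 + (cmod (g x))\<^sup>2)"
    using assms by (simp add: mem_L2_iff)
  have [measurable]: "f \<in> borel_measurable M" "g \<in> borel_measurable M"
    using assms by (simp_all add: mem_L2_iff)
  show "(\<lambda>x. cnj (f x) * g x) \<in> borel_measurable M"
    by (intro borel_measurable_times borel_measurable_continuous_on[OF continuous_on_cnj]
        continuous_on_id) simp_all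
  have "x * y \<le> x\<^sup>2 + y\<^sup>2" for x y :: real
    using sum_squares_bound[of x y] sum_power2_ge_zero[of x y] by linarith
  then show "AE x in M. norm (cnj (f x) * g x) \<le> norm ((cmod (f x))\<^sup>2 + (cmod (g x))\<^sup>2)"
    by (simp add: norm_mult)
qed

lemma cmod_add_square_le: "(cmod (x + y))\<^sup>2 \<le> 2 * (cmod x)\<^sup>2 + 2 * (cmod y)\<^sup>2"
proof -
  have "(cmod (x + y))\<^sup>2 \<le> (cmod x + cmod y)\<^sup>2"
    by (intro power_mono norm_triangle_ineq) simp
  also have "\<dots> \<le> 2 * (cmod x)\<^sup>2 + 2 * (cmod y)\<^sup>2"
    using sum_squares_bound[of "cmod x" "cmod y"] by (simp add: power2_sum)
  finally show ?thesis .
qed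

lemma L2_lincomb:
  assumes "f \<in> vectors (L2 M)" "g \<in> vectors (L2 M)"
  shows "(\<lambda>x. a * f x + b * g x) \<in> vectors (L2 M)"
  unfolding mem_L2_iff
proof
  have [measurable]: "f \<in> borel_measurable M" "g \<in> borel_measurable M"
    using assms by (simp_all add: mem_L2_iff)
  show "(\<lambda>x. a * f x + b * g x) \<in> borel_measurable M"
    by measurable
  show "integrable M (\<lambda>x. (cmod (a * f x + b * g x))\<^sup>2)"
  proof (rule Bochner_Integration.integrable_bound)
    show "integrable M (\<lambda>x. 2 * (cmod a)\<^sup>2 * (cmod (f x))\<^sup>2 + 2 * (cmod b)\<^sup>2 * (cmod (g x))\<^sup>2)"
      using assms by (simp add: mem_L2_iff)
    show "AE x in M. norm ((cmod (a * f x + b * g x))\<^sup>2)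
        \<le> norm (2 * (cmod a)\<^sup>2 * (cmod (f x))\<^sup>2 + 2 * (cmod b)\<^sup>2 * (cmod (g x))\<^sup>2)"
      using cmod_add_square_le[of "a * f x" "b * g x" for x]
      by (simp add: norm_mult power_mult_distrib mult.assoc)
  qed measurable
qed

text \<open>By AM-GM, \<open>2 |f n x| \<le> 2\<^sup>n |f n x|\<^sup>2 + 2\<^sup>-\<^sup>n\<close>, and the first term is integrable after summation.\<close>

lemma AE_summable_of_hnorm_L2:
  assumes f: "\<And>n. f n \<in> vectors (L2 M)" and small: "\<And>n. hnorm (L2 M) (f n) \<le> (1/2) ^ n"
  shows "AE x in M. summable (\<lambda>n. cmod (f n x))"
proof -
  have meas [measurable]: "f n \<in> borel_measurable M" for n
    using f by (simp add: mem_L2_iff)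
  let ?u = "\<lambda>n x. 2 ^ n * (cmod (f n x))\<^sup>2"
  have int: "(\<integral>\<^sup>+x. ennreal (?u n x) \<partial>M) \<le> ennreal ((1/2) ^ n)" for n
  proof -
    have "(\<integral>\<^sup>+x. ennreal (?u n x) \<partial>M) = ennreal (2 ^ n) * (\<integral>\<^sup>+x. ennreal ((cmod (f n x))\<^sup>2) \<partial>M)"
      by (subst nn_integral_cmult[symmetric]) (auto simp: ennreal_mult)
    also have "\<dots> = ennreal (2 ^ n * (hnorm (L2 M) (f n))\<^sup>2)"
      by (simp add: nn_integral_L2 f ennreal_mult)
    also have "\<dots> \<le> ennreal (2 ^ n * ((1/2) ^ n)\<^sup>2)"
      using small[of n] by (intro ennreal_leI mult_left_mono power_mono) (auto simp: hnorm_L2)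
    also have "2 ^ n * ((1/2) ^ n)\<^sup>2 = ((1/2) ^ n :: real)"
      by (simp add: power2_eq_square power_one_over)
    finally show ?thesis .
  qed
  have "(\<integral>\<^sup>+x. (\<Sum>n. ennreal (?u n x)) \<partial>M) = (\<Sum>n. \<integral>\<^sup>+x. ennreal (?u n x) \<partial>M)"
    by (intro nn_integral_suminf) auto
  also have "\<dots> \<le> (\<Sum>n. ennreal ((1/2) ^ n))"
    by (intro suminf_le int) auto
  also have "\<dots> < \<infinity>"
    unfolding infinity_ennreal_def less_top[symmetric]
    by (intro ennreal_suminf_neq_top summable_geometric) auto
  finally have "(\<integral>\<^sup>+x. (\<Sum>n. ennreal (?u n x)) \<partial>M) < \<infinity>" .
  then have "AE x in M. (\<Sum>n. ennreal (?u n x)) \<noteq> \<infinity>"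
    by (intro nn_integral_PInf_AE) auto
  then show ?thesis
  proof eventually_elim
    case (elim x)
    then have "summable (\<lambda>n. ?u n x)"
      by (intro summable_suminf_not_top) auto
    then have sum: "summable (\<lambda>n. ?u n x + (1/2) ^ n)"
      by (intro summable_add summable_geometric) auto
    show "summable (\<lambda>n. cmod (f n x))"
    proof (rule summable_comparison_test[OF _ sum], intro exI allI impI)
      fix n :: nat
      define t where "t = cmod (f n x)"
      have "0 \<le> (2 ^ n * t - 1)\<^sup>2 / 2 ^ n"
        by simp
      also have "\<dots> = 2 ^ n * t\<^sup>2 - 2 * t + (1/2) ^ n"
        by (simp add: power2_eq_square field_simps power_one_over)
      finally have "2 * t \<le> 2 ^ n * t\<^sup>2 + (1/2) ^ n"
        by simp
      moreover have "0 \<le> t" by (simp add: t_def)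
      ultimately have "t \<le> 2 ^ n * t\<^sup>2 + (1/2) ^ n" by linarith
      then show "norm (cmod (f n x)) \<le> 2 ^ n * (cmod (f n x))\<^sup>2 + (1/2) ^ n"
        by (simp add: t_def)
    qed
  qed
qed

text \<open>The Riesz-Fischer argument: a rapidly converging subsequence converges almost everywhere
  by telescoping, and Fatou's lemma carries the Cauchy estimates over to its limit.\<close>

lemma L2_complete:
  assumes X: "\<And>n::nat. X n \<in> vectors (L2 M)"
    and cau: "\<And>e. 0 < e \<Longrightarrow> \<exists>N. \<forall>m\<ge>N. \<forall>n\<ge>N. hnorm (L2 M) (X m - X n) < e"
  shows "\<exists>l\<in>vectors (L2 M). (\<lambda>n. hnorm (L2 M) (X n - l)) \<longlonglongrightarrow> 0"
proof -
  have meas [measurable]: "X n \<in> borel_measurable M" for n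
    using X by (simp add: mem_L2_iff)
  have diff: "f - g \<in> vectors (L2 M)" if "f \<in> vectors (L2 M)" "g \<in> vectors (L2 M)" for f g
    using L2_lincomb[OF that, of 1 "-1"] by (simp add: fun_diff_def)
  have "\<exists>N. \<forall>m\<ge>N. \<forall>n\<ge>N. hnorm (L2 M) (X m - X n) < (1/2) ^ k" for k
    by (rule cau) simp
  then obtain N where N: "\<And>k m n. \<lbrakk>N k \<le> m; N k \<le> n\<rbrakk> \<Longrightarrow> hnorm (L2 M) (X m - X n) < (1/2) ^ k"
    by metis
  \<comment> \<open>Summing makes r increasing, so that \<open>r k\<close> and
    \<open>r (Suc k)\<close> both lie beyond \<open>N k\<close>; the added 1 ensures that r is
    unbounded.\<close>
  define r where "r k = (\<Sum>i\<le>k. N i + 1)" for k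
  have r_ge: "N k \<le> r k" "r k \<le> r (Suc k)" for k
    by (cases k) (simp_all add: r_def)
  have r_k: "k \<le> r k" for k
    by (induction k) (simp_all add: r_def)
  \<comment> \<open>Since \<open>lim\<close> is total, l is defined and measurable everywhere; it is
    the pointwise limit only almost everywhere.\<close>
  define l where "l x = lim (\<lambda>k. X (r k) x)" for x
  have l_meas [measurable]: "l \<in> borel_measurable M"
    unfolding l_def by measurable
  have "AE x in M. summable (\<lambda>k. cmod ((X (r (Suc k)) - X (r k)) x))"
    by (intro AE_summable_of_hnorm_L2 diff X less_imp_le N r_ge order_trans[OF r_ge(1) r_ge(2)])
  then have lim: "AE x in M. (\<lambda>k. X (r k) x) \<longlonglongrightarrow> l x"
  proof eventually_elim
    case (elim x)
    then have "summable (\<lambda>k. X (r (Suc k)) x - X (r k) x)"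
      by (auto intro: summable_norm_cancel)
    then have "convergent (\<lambda>n. \<Sum>k<n. X (r (Suc k)) x - X (r k) x)"
      by (simp add: summable_iff_convergent)
    then have "convergent (\<lambda>n. X (r n) x - X (r 0) x)"
      by (subst (asm) sum_lessThan_telescope)
    then have "convergent (\<lambda>n. (X (r n) x - X (r 0) x) + X (r 0) x)"
      by (intro convergent_add convergent_const)
    then show ?case
      by (simp add: l_def convergent_LIMSEQ_iff)
  qed
  have close: "X n - l \<in> vectors (L2 M) \<and> hnorm (L2 M) (X n - l) \<le> e"
    if e: "0 < e" "\<And>m n. \<lbrakk>K \<le> m; K \<le> n\<rbrakk> \<Longrightarrow> hnorm (L2 M) (X m - X n) < e" "K \<le> n" for e K n
  proof -
    have "(\<integral>\<^sup>+x. ennreal ((cmod ((X n - l) x))\<^sup>2) \<partial>M)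
        = (\<integral>\<^sup>+x. liminf (\<lambda>k. ennreal ((cmod ((X n - X (r k)) x))\<^sup>2)) \<partial>M)"
    proof (rule nn_integral_cong_AE, use lim in eventually_elim)
      case (elim x)
      then have "(\<lambda>k. ennreal ((cmod ((X n - X (r k)) x))\<^sup>2)) \<longlonglongrightarrow> ennreal ((cmod ((X n - l) x))\<^sup>2)"
        by (auto intro!: tendsto_intros)
      then show ?case
        by (rule lim_imp_Liminf[OF sequentially_bot, symmetric])
    qed
    also have "\<dots> \<le> liminf (\<lambda>k. \<integral>\<^sup>+x. ennreal ((cmod ((X n - X (r k)) x))\<^sup>2) \<partial>M)"
      by (intro nn_integral_liminf) (simp add: fun_diff_def)
    also have "\<dots> \<le> ennreal (e\<^sup>2)"
    proof (rule order_trans[OF Liminf_le_Limsup Limsup_bounded])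
      show "\<forall>\<^sub>F k in sequentially. (\<integral>\<^sup>+x. ennreal ((cmod ((X n - X (r k)) x))\<^sup>2) \<partial>M) \<le> ennreal (e\<^sup>2)"
        using eventually_ge_at_top[of K]
      proof eventually_elim
        case (elim k)
        then have "hnorm (L2 M) (X n - X (r k)) < e"
          using r_k[of k] by (intro e(2) e(3)) linarith
        then have "(hnorm (L2 M) (X n - X (r k)))\<^sup>2 \<le> e\<^sup>2"
          by (intro power_mono) (auto simp: hnorm_L2)
        then show ?case
          unfolding nn_integral_L2[OF diff[OF X X]] by (rule ennreal_leI)
      qed
    qed simp
    finally have "(\<integral>\<^sup>+x. ennreal ((cmod ((X n - l) x))\<^sup>2) \<partial>M) \<le> ennreal (e\<^sup>2)" .
    note * = mem_L2_of_nn_integral[of "X n - l", OF _ this]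
    have "X n - l \<in> borel_measurable M"
      by (simp add: fun_diff_def)
    with * show ?thesis
      using e(1) by (auto intro: power2_le_imp_le)
  qed
  obtain K where "\<forall>m\<ge>K. \<forall>n\<ge>K. hnorm (L2 M) (X m - X n) < 1"
    using cau[of 1] by auto
  \<comment> \<open>Membership of l itself follows by writing it as X K - (X K - l).\<close>
  then have "X K - l \<in> vectors (L2 M)"
    using close[of 1 K K] by auto
  from diff[OF X this, of K] have l: "l \<in> vectors (L2 M)"
    by (simp add: fun_diff_def)
  have "(\<lambda>n. hnorm (L2 M) (X n - l)) \<longlonglongrightarrow> 0"
  proof (rule LIMSEQ_I)
    fix e :: real assume "0 < e"
    then obtain K where "\<forall>m\<ge>K. \<forall>n\<ge>K. hnorm (L2 M) (X m - X n) < e / 2"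
      using cau[of "e / 2"] by auto
    then have "hnorm (L2 M) (X n - l) \<le> e / 2" if "K \<le> n" for n
      using close[of "e / 2" K n] that \<open>0 < e\<close> by auto
    with \<open>0 < e\<close> show "\<exists>K. \<forall>n\<ge>K. norm (hnorm (L2 M) (X n - l) - 0) < e"
      by (intro exI[of _ K]) (force simp: hnorm_L2)
  qed
  with l show ?thesis by blast
qed

lemma hilbert_space_L2: "hilbert_space (L2 M)"
proof
  show "(\<lambda>_. 0) \<in> vectors (L2 M)"
    by (simp add: mem_L2_iff)
next
  fix f g h :: "'a \<Rightarrow> complex" and a b
  assume f: "f \<in> vectors (L2 M)"
  show "0 \<le> Re (ip (L2 M) f f)"
    using hnorm_L2[of M f] by (simp add: hnorm_def)
  assume g: "g \<in> vectors (L2 M)"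
  show "(\<lambda>i. a * f i + b * g i) \<in> vectors (L2 M)"
    by (rule L2_lincomb[OF f g])
  show "ip (L2 M) g f = cnj (ip (L2 M) f g)"
    by (simp add: L2_def mult.commute flip: Bochner_Integration.integral_cnj)
  assume h: "h \<in> vectors (L2 M)"
  show "ip (L2 M) h (\<lambda>i. a * f i + b * g i) = a * ip (L2 M) h f + b * ip (L2 M) h g"
    using integrable_L2_product[OF h f] integrable_L2_product[OF h g]
    by (simp add: L2_def algebra_simps)
qed (rule L2_complete)

section \<open>Weighted sequence spaces as \<open>L2\<close> spaces\<close>

text \<open>Agreement of the inner products is required on vectors only, because a series and the
  corresponding integral are identified below just for integrable terms.\<close>

lemma hilbert_space_cong:
  assumes H: "hilbert_space H" and vec: "vectors H' = vectors H"
    and ip: "\<And>f g. \<lbrakk>f \<in> vectors H; g \<in> vectors H\<rbrakk> \<Longrightarrow> ip H' f g = ip H f g"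
  shows "hilbert_space H'"
proof
  interpret hilbert_space H by (fact H)
  note mem = zero_mem lincomb_mem diff_mem
  show "(\<lambda>_. 0) \<in> vectors H'"
    by (simp add: vec mem)
  fix f g h :: "'a \<Rightarrow> complex" and a b
  assume "f \<in> vectors H'"
  then have f: "f \<in> vectors H" by (simp add: vec)
  then show "0 \<le> Re (ip H' f f)"
    by (simp add: ip ip_nonneg)
  assume "g \<in> vectors H'"
  then have g: "g \<in> vectors H" by (simp add: vec)
  then show "(\<lambda>i. a * f i + b * g i) \<in> vectors H'"
    using f by (simp add: vec mem)
  show "ip H' g f = cnj (ip H' f g)"
    using f g ip_commute[of f g] by (simp add: ip)
  assume "h \<in> vectors H'"
  then have h: "h \<in> vectors H" by (simp add: vec)
  show "ip H' h (\<lambda>i. a * f i + b * g i) = a * ip H' h f + b * ip H' h g"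
    using f g h by (simp add: ip mem ip_lincomb_right)
next
  interpret hilbert_space H by (fact H)
  have hnorm: "hnorm H' (f - g) = hnorm H (f - g)" if "f \<in> vectors H" "g \<in> vectors H" for f g
    using diff_mem[OF that] by (simp add: hnorm_def ip)
  fix X :: "nat \<Rightarrow> 'a \<Rightarrow> complex"
  assume "\<And>n. X n \<in> vectors H'"
  then have X: "X n \<in> vectors H" for n by (simp add: vec)
  assume "\<And>e. 0 < e \<Longrightarrow> \<exists>N. \<forall>m\<ge>N. \<forall>n\<ge>N. hnorm H' (X m - X n) < e"
  then have "\<exists>l\<in>vectors H. (\<lambda>n. hnorm H (X n - l)) \<longlonglongrightarrow> 0"
    by (intro complete X) (simp add: hnorm X)
  then show "\<exists>l\<in>vectors H'. (\<lambda>n. hnorm H' (X n - l)) \<longlonglongrightarrow> 0"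
    by (simp add: vec hnorm X cong: bex_cong)
qed

lemma mem_ell2_iff: "c \<in> vectors (ell2 w) \<longleftrightarrow> summable (\<lambda>i. w i * (cmod (c i))\<^sup>2)"
  by (simp add: ell2_def)

text \<open>\<open>ell2 w\<close> is \<open>L2\<close> of the counting measure with density w, so
  completeness is inherited.\<close>

lemma hilbert_space_ell2:
  assumes "\<And>i. w i > 0"
  shows "hilbert_space (ell2 w)"
proof (rule hilbert_space_cong[OF hilbert_space_L2])
  let ?N = "density (count_space UNIV) (\<lambda>i. ennreal (w i))"
  have nonneg: "0 \<le> w i" for i
    using assms[of i] by simp
  show vec: "vectors (ell2 w) = vectors (L2 ?N)"
    using nonneg
    by (auto simp: mem_ell2_iff mem_L2_iff integrable_density integrable_count_space_nat_iff abs_mult)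
  fix f g assume "f \<in> vectors (L2 ?N)" "g \<in> vectors (L2 ?N)"
  from integrable_L2_product[OF this]
  have "integrable (count_space UNIV) (\<lambda>i. complex_of_real (w i) * (cnj (f i) * g i))"
    by (simp add: integrable_density nonneg scaleR_conv_of_real)
  then show "ip (ell2 w) f g = ip (L2 ?N) f g"
    by (simp add: ell2_def L2_def integral_density nonneg scaleR_conv_of_real
        integral_count_space_nat mult.assoc)
qed

section \<open>Polynomials in \<open>L2 \<mu>\<close>\<close>

text \<open>The complement of the support is the union of all open null sets; by Lindelof countably
  many of them suffice.\<close>

lemma AE_measure_support:
  fixes \<mu> :: "'a::second_countable_topology measure"
  assumes borel: "sets \<mu> = sets borel"
  shows "AE x in \<mu>. x \<in> measure_support \<mu>"
proof -
  let ?N = "{U. open U \<and> emeasure \<mu> U = 0}"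
  obtain N where N: "N \<subseteq> ?N" "countable N" "\<Union>N = \<Union>?N"
    using Lindelof[of ?N] by blast
  have "U \<in> null_sets \<mu>" if "U \<in> N" for U
    using that N(1) borel by (auto simp: null_sets_def)
  then have "\<Union>N \<in> null_sets \<mu>"
    using null_sets_UN'[OF N(2), of "\<lambda>U. U" \<mu>] by simp
  then show ?thesis
  proof (rule AE_I')
    show "{x \<in> space \<mu>. x \<notin> measure_support \<mu>} \<subseteq> \<Union>N"
      unfolding N(3) by (auto simp: measure_support_def)
  qed
qed

lemma integrable_bounded_scaleR:
  fixes f :: "'a \<Rightarrow> 'b::{banach, second_countable_topology}" and g :: "'a \<Rightarrow> real"
  assumes "integrable M f" "g \<in> borel_measurable M" "AE x in M. \<bar>g x\<bar> \<le> C"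
  shows "integrable M (\<lambda>x. g x *\<^sub>R f x)"
proof (rule Bochner_Integration.integrable_bound)
  show "integrable M (\<lambda>x. C * norm (f x))"
    using assms(1) by simp
  show "(\<lambda>x. g x *\<^sub>R f x) \<in> borel_measurable M"
    using assms(1,2) by simp
  show "AE x in M. norm (g x *\<^sub>R f x) \<le> norm (C * norm (f x))"
    using assms(3)
  proof eventually_elim
    case (elim x)
    have "\<bar>g x\<bar> * norm (f x) \<le> \<bar>C\<bar> * norm (f x)"
      using elim by (intro mult_right_mono) auto
    then show ?case by (simp add: abs_mult)
  qed
qed

lemma AE_bounded_of_continuous:
  fixes g :: "real \<Rightarrow> real"
  assumes "AE x in M. x \<in> {a..b}" "continuous_on {a..b} g"
  obtains C where "AE x in M. \<bar>g x\<bar> \<le> C"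
proof -
  have "bounded (g ` {a..b})"
    using assms(2) by (intro compact_imp_bounded compact_continuous_image) auto
  then obtain C where "\<And>x. x \<in> {a..b} \<Longrightarrow> \<bar>g x\<bar> \<le> C"
    by (force simp: bounded_iff)
  with assms(1) show thesis
    by (intro that[of C]) (auto elim: eventually_mono)
qed

text \<open>The moments determine the integrals of \<open>f\<close> against continuous functions by Weierstrass, then
  over closed sets by approximating their indicator functions, and then over all Borel sets.\<close>

lemma AE_zero_of_moments_zero:
  fixes f :: "real \<Rightarrow> 'b::{banach, second_countable_topology}"
  assumes "finite_measure M" and borel: "sets M = sets borel" and int: "integrable M f"
    and supp: "AE x in M. x \<in> {a..b}"
    and zero: "\<And>k::nat. (\<integral>x. x ^ k *\<^sub>R f x \<partial>M) = 0"
  shows "AE x in M. f x = 0"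
proof -
  interpret finite_measure M by fact
  have meas: "g \<in> borel_measurable M" if "continuous_on UNIV g" for g :: "real \<Rightarrow> real"
    using borel_measurable_continuous_onI[OF that] borel measurable_cong_sets[OF borel refl] by blast
  have space: "space M = UNIV"
    using sets_eq_imp_space_eq[OF borel] by simp
  have int': "integrable M (\<lambda>x. g x *\<^sub>R f x)" if g: "continuous_on UNIV g" for g
  proof -
    obtain C where "AE x in M. \<bar>g x\<bar> \<le> C"
      using AE_bounded_of_continuous[OF supp continuous_on_subset[OF g]] by blast
    then show ?thesis
      by (intro integrable_bounded_scaleR int meas g)
  qed
  have poly: "(\<integral>x. p x *\<^sub>R f x \<partial>M) = 0" if p: "real_polynomial_function p" for p
  proof -
    obtain c n where c: "p = (\<lambda>x. \<Sum>i\<le>n. c i * x ^ i)"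
      using p real_polynomial_function_iff_sum by blast
    have "integrable M (\<lambda>x. x ^ i *\<^sub>R f x)" for i
      by (intro int' continuous_intros)
    then show ?thesis
      by (simp add: c scaleR_sum_left Bochner_Integration.integral_sum zero flip: scaleR_scaleR)
  qed
  have cont: "(\<integral>x. g x *\<^sub>R f x \<partial>M) = 0" if g: "continuous_on UNIV g" for g
  proof -
    have "norm (\<integral>x. g x *\<^sub>R f x \<partial>M) \<le> e * (\<integral>x. norm (f x) \<partial>M)" if e: "0 < e" for e
    proof -
      obtain p where p: "real_polynomial_function p" "\<And>x. x \<in> {a..b} \<Longrightarrow> \<bar>g x - p x\<bar> < e"
        using Stone_Weierstrass_real_polynomial_function[of "{a..b}" g e] e
          continuous_on_subset[OF g] by blast
      have pc: "continuous_on UNIV p"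
        using p(1) by (simp add: continuous_on_polymonial_function real_polynomial_function_eq)
      have "(\<integral>x. g x *\<^sub>R f x \<partial>M) = (\<integral>x. g x *\<^sub>R f x - p x *\<^sub>R f x \<partial>M)"
        by (simp add: int' g pc poly[OF p(1)])
      also have "norm \<dots> \<le> (\<integral>x. norm (g x *\<^sub>R f x - p x *\<^sub>R f x) \<partial>M)"
        by (rule integral_norm_bound)
      also have "\<dots> \<le> (\<integral>x. e * norm (f x) \<partial>M)"
      proof (rule integral_mono_AE)
        show "AE x in M. norm (g x *\<^sub>R f x - p x *\<^sub>R f x) \<le> e * norm (f x)"
          using supp
        proof eventually_elim
          case (elim x)
          have "\<bar>g x - p x\<bar> * norm (f x) \<le> e * norm (f x)"
            using p(2)[OF elim] by (intro mult_right_mono) auto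
          then show ?case
            by (simp flip: scaleR_diff_left)
        qed
      qed (use int int' g pc in auto)
      finally show ?thesis by simp
    qed
    then have "norm (\<integral>x. g x *\<^sub>R f x \<partial>M) \<le> 0 + e" if "0 < e" for e
    proof -
      let ?I = "\<integral>x. norm (f x) \<partial>M"
      have I: "0 \<le> ?I" and "0 < 1 + ?I" by (simp_all add: add_pos_nonneg)
      \<comment> \<open>Division by \<open>?I + 1\<close> also covers the case in which the integral
        of the norm of f is zero.\<close>
      have "norm (\<integral>x. g x *\<^sub>R f x \<partial>M) \<le> e / (?I + 1) * ?I"
        using I that by (intro \<open>\<And>e. 0 < e \<Longrightarrow> _ e\<close>) (simp add: add_nonneg_pos)
      also have "\<dots> \<le> e"
        using I that by (simp add: pos_divide_le_eq add_nonneg_pos algebra_simps \<open>0 < 1 + ?I\<close>)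
      finally show ?thesis by simp
    qed
    then have "norm (\<integral>x. g x *\<^sub>R f x \<partial>M) \<le> 0"
      by (rule field_le_epsilon)
    then show ?thesis by simp
  qed
  have closed: "(LINT x:A|M. f x) = 0" if "closed A" for A
  \<comment> \<open>The empty set is separate because \<open>infdist x {}\<close> is 0, so the
    cutoffs below would be constantly 1. For nonempty A they are continuous and decrease to the
    indicator of A.\<close>
  proof (cases "A = {}")
    case False
    define g where "g n x = max 0 (1 - real n * infdist x A)" for n x
    have gc: "continuous_on UNIV (g n)" for n
      unfolding g_def by (intro continuous_intros)
    have lim: "(\<lambda>n. g n x) \<longlonglongrightarrow> indicator A x" for x
    proof (cases "x \<in> A")
      case True
      then show ?thesis by (simp add: g_def)
    next
      case x: False
      then have "0 < infdist x A"
        using \<open>closed A\<close> False in_closed_iff_infdist_zero[of A x] infdist_nonneg[of x A] by force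
      then obtain N :: nat where N: "1 < real N * infdist x A"
        using reals_Archimedean3 by blast
      have "g n x = 0" if "N \<le> n" for n
      proof -
        have "real N * infdist x A \<le> real n * infdist x A"
          using that by (intro mult_right_mono infdist_nonneg) simp
        with N show ?thesis by (simp add: g_def)
      qed
      then have "\<forall>\<^sub>F n in sequentially. g n x = 0"
        using eventually_sequentially by blast
      with x show ?thesis
        by (simp add: tendsto_eventually)
    qed
    have "(\<lambda>n. \<integral>x. g n x *\<^sub>R f x \<partial>M) \<longlonglongrightarrow> (\<integral>x. indicator A x *\<^sub>R f x \<partial>M)"
    proof (rule integral_dominated_convergence)
      show "integrable M (\<lambda>x. norm (f x))"
        using int by simp
      show "(\<lambda>x. indicator A x *\<^sub>R f x) \<in> borel_measurable M"
        using borel_measurable_integrable[OF int] borel borel_closed[OF \<open>closed A\<close>]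
        by (intro borel_measurable_scaleR borel_measurable_indicator) auto
      show "(\<lambda>x. g n x *\<^sub>R f x) \<in> borel_measurable M" for n
        by (rule borel_measurable_integrable[OF int'[OF gc]])
      show "AE x in M. (\<lambda>n. g n x *\<^sub>R f x) \<longlonglongrightarrow> indicator A x *\<^sub>R f x"
        by (intro AE_I2 tendsto_intros lim)
      have "\<bar>g n x\<bar> \<le> 1" for n x
        by (simp add: g_def infdist_nonneg)
      then show "AE x in M. norm (g n x *\<^sub>R f x) \<le> norm (f x)" for n
        by (intro AE_I2) (simp add: mult_left_le_one_le)
    qed
    then show ?thesis
      using LIMSEQ_unique[OF tendsto_const] unfolding cont[OF gc] set_lebesgue_integral_def by metis
  qed (simp add: set_lebesgue_integral_def)
  have "(LINT x:A|M. f x) = 0" if "A \<in> sets M" for A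
  proof -
    from that have A: "A \<in> sigma_sets UNIV (Collect closed)"
      using borel by (simp add: borel_eq_closed)
    have sets: "B \<in> sets M" if "B \<in> sigma_sets UNIV (Collect closed)" for B
      using that borel by (simp add: borel_eq_closed)
    \<comment> \<open>Closed sets are stable under intersection and generate the Borel sets, so
      induction over complements and disjoint unions is available.\<close>
    have "Int_stable (Collect closed :: real set set)"
      by (auto simp: Int_stable_def)
    moreover have "Collect closed \<subseteq> Pow (UNIV :: real set)"
      by simp
    ultimately show ?thesis
      using A
    proof (induction A rule: sigma_sets_induct_disjoint)
      case (basic A)
      then show ?case by (simp add: closed)
    next
      case empty
      then show ?case by (simp add: set_lebesgue_integral_def)
    next
      case (compl A)
      have "(LINT x:(UNIV - A)|M. f x) = (\<integral>x. f x - indicator A x *\<^sub>R f x \<partial>M)"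
        unfolding set_lebesgue_integral_def
        by (intro Bochner_Integration.integral_cong) (auto split: split_indicator)
      also have "\<dots> = (\<integral>x. f x \<partial>M) - (LINT x:A|M. f x)"
        using sets[OF compl(1)] int unfolding set_lebesgue_integral_def
        by (intro Bochner_Integration.integral_diff) (auto intro: integrable_mult_indicator)
      \<comment> \<open>The moment of order 0 says that the integral over the whole space
        vanishes.\<close>
      finally show ?case
        using compl(2) zero[of 0] by simp
    next
      case (union A)
      have "(LINT x:(\<Union>i. A i)|M. f x) = (\<Sum>i. LINT x:A i|M. f x)"
      proof (rule lebesgue_integral_countable_add)
        show mem: "A i \<in> sets M" for i
          using union(2) sets by blast
        show "A i \<inter> A j = {}" if "i \<noteq> j" for i j
          using union(1) that by (auto simp: disjoint_family_on_def)
        show "set_integrable M (\<Union>i. A i) f"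
          unfolding set_integrable_def using mem int by (intro integrable_mult_indicator) auto
      qed
      then show ?case
        by (simp add: union(3))
    qed
  qed
  then show ?thesis
    by (rule density_zero[OF int])
qed

section \<open>The operator \<open>K\<close>\<close>

locale moment_operator =
  fixes \<mu> :: "real measure" and w :: "nat \<Rightarrow> real"
  assumes borel: "sets \<mu> = sets borel"
    and supp: "measure_support \<mu> \<subseteq> {-1..1}"
    and mom: "\<And>j::nat. integrable \<mu> (\<lambda>x. x ^ j)"
    and weights: "\<And>i. w i > 0"
    and sum_mom: "\<And>k::nat. summable (\<lambda>j. (1 / w j) * \<bar>moment \<mu> (j + k)\<bar>\<^sup>2)"
begin

lemma space_UNIV [simp]: "space \<mu> = UNIV"
  using sets_eq_imp_space_eq[OF borel] by simp

lemma measurable_eq: "borel_measurable \<mu> = borel_measurable borel"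
  by (rule measurable_cong_sets[OF borel refl])

sublocale finite_measure \<mu>
proof
  have "integrable \<mu> (\<lambda>_. 1 :: real)"
    using mom[of 0] by simp
  then show "emeasure \<mu> (space \<mu>) \<noteq> \<infinity>"
    by (simp add: integrable_iff_bounded)
qed

sublocale H1: hilbert_space "ell2 w"
  by (rule hilbert_space_ell2) (rule weights)

sublocale H2: hilbert_space "L2 \<mu>"
  by (rule hilbert_space_L2)

lemma AE_support: "AE x in \<mu>. x \<in> {-1..1}"
  using AE_measure_support[OF borel] by (rule eventually_mono) (use supp in blast)

lemma AE_le_1: "AE x in \<mu>. \<bar>x\<bar> \<le> 1"
  using AE_support by (auto elim: eventually_mono)

section \<open>Convergence of the kernel series and the essential radius\<close>

lemma summable_of_emeasure_pos:
  assumes s: "0 \<le> s" and pos: "0 < emeasure \<mu> {y. s \<le> \<bar>y\<bar>}"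
  shows "summable (\<lambda>j. s ^ (2 * j) / w j)"
\<comment> \<open>The general estimate divides by a power of s. For s = 0 only the term j = 0
  survives, since 0 ^ 0 = 1.\<close>
proof (cases "s = 0")
  case True
  have "summable (\<lambda>j. if j = 0 then 1 / w 0 else 0)"
    by simp
  then show ?thesis
    by (rule back_subst[of summable]) (auto simp: True fun_eq_iff)
next
  case False
  with s have "0 < s" by simp
  let ?A = "{y. s \<le> \<bar>y\<bar>}"
  have A: "?A \<in> sets \<mu>"
    using borel by simp
  define m where "m = measure \<mu> ?A"
  have m: "0 < m"
    using pos by (simp add: m_def emeasure_eq_measure)
  have moment_ge: "s ^ n * m \<le> moment \<mu> n" if "even n" for n
  proof -
    have "s ^ n * m = (\<integral>x. s ^ n * indicator ?A x \<partial>\<mu>)"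
      using A by (simp add: m_def)
    also have "\<dots> \<le> (\<integral>x. x ^ n \<partial>\<mu>)"
    proof (rule integral_mono)
      show "integrable \<mu> (\<lambda>x. s ^ n * indicator ?A x)"
        by (intro integrable_mult_right integrable_real_indicator A) (simp add: less_top[symmetric])
      show "s ^ n * indicator ?A x \<le> x ^ n" for x
        using power_mono[of s "\<bar>x\<bar>" n] s that by (auto split: split_indicator simp: power_even_abs)
    qed (rule mom)
    finally show ?thesis by (simp add: moment_def)
  qed
  let ?t = "\<lambda>k j. 1 / w j * \<bar>moment \<mu> (j + k)\<bar>\<^sup>2"
  have t_nonneg: "0 \<le> ?t k j" for k j
    using weights[of j] by simp
  \<comment> \<open>Odd moments may cancel, so the lower bound is available only for even j + k; k =
    0 serves the even j and k = 1 the odd ones.\<close>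
  have t_ge: "s ^ (2 * j) / w j \<le> 1 / (m\<^sup>2 * s ^ (2 * k)) * ?t k j" if "even (j + k)" for j k
  proof -
    have "s ^ (2 * j) * s ^ (2 * k) * m\<^sup>2 = (s ^ (j + k) * m)\<^sup>2"
      by (simp only: power2_eq_square mult_2 mult_2_right power_add ac_simps)
    also have "\<dots> \<le> \<bar>moment \<mu> (j + k)\<bar>\<^sup>2"
      using moment_ge[OF that] s m by (intro power_mono) auto
    finally have "s ^ (2 * j) \<le> 1 / (m\<^sup>2 * s ^ (2 * k)) * \<bar>moment \<mu> (j + k)\<bar>\<^sup>2"
      using \<open>0 < s\<close> m by (simp add: field_simps)
    from divide_right_mono[OF this less_imp_le[OF weights[of j]]] show ?thesis
      by simp
  qed
  have "summable (\<lambda>j. 1 / (m\<^sup>2 * s ^ (2 * 0)) * ?t 0 j + 1 / (m\<^sup>2 * s ^ (2 * 1)) * ?t 1 j)"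
    by (intro summable_add summable_mult sum_mom)
  then show ?thesis
  proof (rule summable_comparison_test[rotated], intro exI allI impI)
    fix j
    have nonneg: "0 \<le> 1 / (m\<^sup>2 * s ^ (2 * k)) * ?t k j" for k
      using s by (intro mult_nonneg_nonneg t_nonneg) simp
    have "s ^ (2 * j) / w j
        \<le> 1 / (m\<^sup>2 * s ^ (2 * 0)) * ?t 0 j + 1 / (m\<^sup>2 * s ^ (2 * 1)) * ?t 1 j"
    proof (cases "even j")
      case True
      with t_ge[of j 0] nonneg[of 1] show ?thesis by simp
    next
      case False
      with t_ge[of j 1] nonneg[of 0] show ?thesis by simp
    qed
    then show "norm (s ^ (2 * j) / w j)
        \<le> 1 / (m\<^sup>2 * s ^ (2 * 0)) * ?t 0 j + 1 / (m\<^sup>2 * s ^ (2 * 1)) * ?t 1 j"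
      using s weights[of j] by (simp add: abs_mult power_abs)
  qed
qed

lemma summable_power_mono:
  assumes "summable (\<lambda>j. b ^ j / w j)" "\<bar>a\<bar> \<le> b"
  shows "summable (\<lambda>j. \<bar>a ^ j / w j\<bar>)" "summable (\<lambda>j. a ^ j / w j)"
proof -
  have "norm (\<bar>a ^ j / w j\<bar>) \<le> b ^ j / w j" for j
    using power_mono[OF assms(2), of j] weights[of j]
    by (simp add: power_abs divide_right_mono)
  then show "summable (\<lambda>j. \<bar>a ^ j / w j\<bar>)"
    using assms(1) by (intro summable_comparison_test[OF _ assms(1)]) blast
  then show "summable (\<lambda>j. a ^ j / w j)"
    by (rule summable_rabs_cancel)
qed

text \<open>\<open>r\<close> is the essential supremum of \<open>|x|\<close>. If \<open>|x| < r\<close>, then \<open>|x| r < s\<^sup>2\<close> for some \<open>s < r\<close>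
  that still satisfies \<open>\<mu> {y. s \<le> |y|} > 0\<close>; otherwise \<open>|x| = r\<close> is an atom of the law of \<open>|x|\<close>.\<close>

lemma essential_radius:
  obtains r where "0 \<le> r" "AE x in \<mu>. \<bar>x\<bar> \<le> r" "AE x in \<mu>. summable (\<lambda>j. (\<bar>x\<bar> * r) ^ j / w j)"
proof -
  let ?A = "\<lambda>s. {y::real. s \<le> \<bar>y\<bar>}"
  define P where "P = {s. 0 \<le> s \<and> 0 < emeasure \<mu> (?A s)}"
  have A: "?A s \<in> sets \<mu>" for s
    using borel by simp
  have AE: "AE y in \<mu>. \<bar>y\<bar> < s" if "0 \<le> s" "s \<notin> P" for s
  proof -
    have "?A s \<in> null_sets \<mu>"
      using that A by (auto simp: P_def null_sets_def)
    then show ?thesis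
      by (rule AE_I') auto
  qed
  show thesis
  proof (cases "0 \<in> P")
    case False
    \<comment> \<open>Here \<mu> is the zero measure and any radius will do.\<close>
    have "AE x in \<mu>. False"
      using AE[OF _ False] by simp
    then show thesis
      by (intro that[of 0]) auto
  next
    case True
    have le_1: "s \<le> 1" if "s \<in> P" for s
    proof (rule ccontr)
      assume "\<not> s \<le> 1"
      then have "AE y in \<mu>. y \<notin> ?A s"
        using AE_le_1 by (auto elim: eventually_mono)
      then have "emeasure \<mu> (?A s) = 0"
        using AE_iff_null_sets[OF A] null_setsD1 by blast
      with that show False by (simp add: P_def)
    qed
    then have bdd: "bdd_above P"
      by (auto simp: bdd_above_def)
    define r where "r = Sup P"
    have r0: "0 \<le> r"
      unfolding r_def using True bdd by (rule cSup_upper)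
    \<comment> \<open>Countably many levels above the supremum are used so that the exceptional null
      sets can be united.\<close>
    have "AE y in \<mu>. \<bar>y\<bar> < r + 1 / real (Suc n)" for n
    proof (rule AE)
      show "r + 1 / real (Suc n) \<notin> P"
        using cSup_upper[OF _ bdd, of "r + 1 / real (Suc n)"] by (auto simp: r_def)
    qed (use r0 in simp)
    then have "AE y in \<mu>. \<forall>n. \<bar>y\<bar> < r + 1 / real (Suc n)"
      by (simp add: AE_all_countable)
    then have AE_r: "AE y in \<mu>. \<bar>y\<bar> \<le> r"
    proof eventually_elim
      case (elim y)
      show "\<bar>y\<bar> \<le> r"
      proof (rule field_le_epsilon)
        fix e :: real assume "0 < e"
        then obtain n where "inverse (real (Suc n)) < e"
          using reals_Archimedean by blast
        with elim[rule_format, of n] show "\<bar>y\<bar> \<le> r + e"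
          by (simp add: inverse_eq_divide)
      qed
    qed
    have "AE x in \<mu>. summable (\<lambda>j. (\<bar>x\<bar> * r) ^ j / w j)"
    proof (cases "r \<in> P")
      case True
      then have sum: "summable (\<lambda>j. (r\<^sup>2) ^ j / w j)"
        using summable_of_emeasure_pos[of r] by (simp add: P_def power_mult)
      from AE_r show ?thesis
      proof eventually_elim
        case (elim x)
        with r0 have "\<bar>\<bar>x\<bar> * r\<bar> \<le> r\<^sup>2"
          by (simp add: power2_eq_square abs_mult mult_right_mono)
        with sum show ?case
          by (rule summable_power_mono(2))
      qed
    next
      case False
      from AE[OF r0 this] show ?thesis
      proof eventually_elim
        case (elim x)
        have "\<bar>x\<bar> * r < r\<^sup>2"
          using elim by (simp add: power2_eq_square mult_strict_right_mono)
        then have "sqrt (\<bar>x\<bar> * r) < r"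
          using r0 real_less_lsqrt by force
        then obtain s where s: "s \<in> P" "sqrt (\<bar>x\<bar> * r) < s"
          unfolding r_def using less_cSup_iff[OF _ bdd] \<open>0 \<in> P\<close> by blast
        then have "\<bar>\<bar>x\<bar> * r\<bar> \<le> s\<^sup>2"
          using r0 by (simp add: P_def sqrt_le_D less_imp_le abs_mult)
        moreover have "summable (\<lambda>j. (s\<^sup>2) ^ j / w j)"
          using summable_of_emeasure_pos[of s] s(1) by (simp add: P_def power_mult)
        ultimately show ?case
          by (rule summable_power_mono(2)[rotated])
      qed
    qed
    with r0 AE_r show thesis by (rule that)
  qed
qed

section \<open>The polynomial operator and its adjoint\<close>

abbreviation poly_graph where "poly_graph \<equiv> {(c, poly_fun c) | c. c \<in> fin_seqs}"

text \<open>Allows polynomials with different supports to be summed over a common index set.\<close>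

lemma poly_fun_eq_sum:
  assumes "finite S" "{i. c i \<noteq> 0} \<subseteq> S"
  shows "poly_fun c x = (\<Sum>i\<in>S. c i * complex_of_real x ^ i)"
  unfolding poly_fun_def using assms by (intro sum.mono_neutral_left) auto

lemma fin_seqs_lincomb:
  assumes "c \<in> fin_seqs" "d \<in> fin_seqs"
  shows "(\<lambda>i. a * c i + b * d i) \<in> fin_seqs"
    "poly_fun (\<lambda>i. a * c i + b * d i) = (\<lambda>x. a * poly_fun c x + b * poly_fun d x)"
proof -
  let ?S = "{i. c i \<noteq> 0} \<union> {i. d i \<noteq> 0}"
  have fin: "finite ?S"
    using assms by (simp add: fin_seqs_def)
  have sub: "{i. a * c i + b * d i \<noteq> 0} \<subseteq> ?S" by auto
  then show "(\<lambda>i. a * c i + b * d i) \<in> fin_seqs"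
    using fin finite_subset by (auto simp: fin_seqs_def)
  show "poly_fun (\<lambda>i. a * c i + b * d i) = (\<lambda>x. a * poly_fun c x + b * poly_fun d x)"
  proof
    fix x
    show "poly_fun (\<lambda>i. a * c i + b * d i) x = a * poly_fun c x + b * poly_fun d x"
      using poly_fun_eq_sum[OF fin sub, of x] poly_fun_eq_sum[OF fin, of c x]
        poly_fun_eq_sum[OF fin, of d x]
      by (simp add: sum.distrib sum_distrib_left algebra_simps)
  qed
qed

lemma fin_seqs_ell2: "c \<in> fin_seqs \<Longrightarrow> c \<in> vectors (ell2 w)"
  unfolding mem_ell2_iff fin_seqs_def by (auto intro!: summable_finite)

lemma L2_of_bounded:
  assumes "f \<in> borel_measurable borel" "AE x in \<mu>. cmod (f x) \<le> C"
  shows "f \<in> vectors (L2 \<mu>)"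
proof -
  have "integrable \<mu> (\<lambda>x. (cmod (f x))\<^sup>2)"
  proof (rule integrable_const_bound[of _ "C\<^sup>2"])
    show "AE x in \<mu>. norm ((cmod (f x))\<^sup>2) \<le> C\<^sup>2"
      using assms(2) by (auto elim!: eventually_mono intro: power_mono)
    show "(\<lambda>x. (cmod (f x))\<^sup>2) \<in> borel_measurable \<mu>"
      using assms(1) by (simp add: measurable_eq)
  qed
  then show ?thesis
    using assms(1) by (simp add: mem_L2_iff measurable_eq)
qed

lemma power_L2: "(\<lambda>x. complex_of_real x ^ k) \<in> vectors (L2 \<mu>)"
proof (rule L2_of_bounded)
  show "AE x in \<mu>. cmod (complex_of_real x ^ k) \<le> 1"
    using AE_le_1 by (auto elim!: eventually_mono simp: norm_power intro: power_le_one)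
  show "(\<lambda>x. complex_of_real x ^ k) \<in> borel_measurable borel"
    by (intro borel_measurable_continuous_onI continuous_intros)
qed

lemma poly_fun_L2: "poly_fun c \<in> vectors (L2 \<mu>)"
proof (rule L2_of_bounded)
  show "poly_fun c \<in> borel_measurable borel"
    unfolding poly_fun_def[abs_def] by (intro borel_measurable_continuous_onI continuous_intros)
  show "AE x in \<mu>. cmod (poly_fun c x) \<le> (\<Sum>i | c i \<noteq> 0. cmod (c i))"
    using AE_le_1
  proof eventually_elim
    case (elim x)
    have "cmod (c i * complex_of_real x ^ i) \<le> cmod (c i)" for i
      using elim by (simp add: norm_mult norm_power mult_left_le power_le_one)
    then show ?case
      unfolding poly_fun_def by (intro sum_norm_le)
  qed
qed

lemma poly_graph_subset: "poly_graph \<subseteq> vectors (ell2 w) \<times> vectors (L2 \<mu>)"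
  using fin_seqs_ell2 poly_fun_L2 by auto

definition unit_seq :: "nat \<Rightarrow> nat \<Rightarrow> complex" where
  "unit_seq j = (\<lambda>i. if i = j then 1 else 0)"

lemma unit_seq_fin_seqs: "unit_seq j \<in> fin_seqs"
  by (simp add: unit_seq_def fin_seqs_def)

lemma poly_fun_unit_seq: "poly_fun (unit_seq j) = (\<lambda>x. complex_of_real x ^ j)"
  using poly_fun_eq_sum[of "{j}" "unit_seq j"] by (auto simp: unit_seq_def fun_eq_iff)

lemma ip_unit_seq: "ip (ell2 w) c (unit_seq j) = complex_of_real (w j) * cnj (c j)"
proof -
  have "(\<Sum>i. complex_of_real (w i) * cnj (c i) * unit_seq j i)
      = (\<Sum>i\<in>{j}. complex_of_real (w i) * cnj (c i) * unit_seq j i)"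
    by (rule suminf_finite) (auto simp: unit_seq_def)
  then show ?thesis
    by (simp add: ell2_def unit_seq_def)
qed

lemma integral_power_mult:
  "(\<integral>x. complex_of_real x ^ i * complex_of_real x ^ k \<partial>\<mu>) = complex_of_real (moment \<mu> (i + k))"
proof -
  have "complex_of_real x ^ i * complex_of_real x ^ k = complex_of_real (x ^ (i + k))" for x
    by (simp add: power_add)
  then show ?thesis
    by (simp only: integral_complex_of_real moment_def)
qed

text \<open>The squared norm of the sequence with entries M_(j+k) / w_j in \<open>ell2 w\<close> is
  the series in \<open>sum_mom\<close>, so that hypothesis places every monomial in the domain of
  the adjoint.\<close>

lemma power_mem_adjoint:
  "((\<lambda>x. complex_of_real x ^ k), (\<lambda>j. complex_of_real (moment \<mu> (j + k) / w j)))
    \<in> adjoint_op (ell2 w) (L2 \<mu>) poly_graph"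
  unfolding mem_adjoint_op_iff
proof (intro conjI allI impI)
  let ?d = "\<lambda>j. complex_of_real (moment \<mu> (j + k) / w j)"
  have "w j * (cmod (?d j))\<^sup>2 = (1 / w j) * \<bar>moment \<mu> (j + k)\<bar>\<^sup>2" for j
    using weights[of j] by (simp add: norm_divide power_divide power2_eq_square)
  then show "?d \<in> vectors (ell2 w)"
    using sum_mom[of k] by (simp add: mem_ell2_iff)
  fix c q assume "(c, q) \<in> poly_graph"
  then have c: "finite {i. c i \<noteq> 0}" and q: "q = poly_fun c"
    by (auto simp: fin_seqs_def)
  let ?S = "{i. c i \<noteq> 0}"
  have "ip (L2 \<mu>) (\<lambda>x. complex_of_real x ^ k) q
      = (\<integral>x. (\<Sum>i\<in>?S. c i * (complex_of_real x ^ i * complex_of_real x ^ k)) \<partial>\<mu>)"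
    by (simp add: L2_def q poly_fun_def sum_distrib_left mult_ac)
  also have "\<dots> = (\<Sum>i\<in>?S. c i * complex_of_real (moment \<mu> (i + k)))"
  proof (subst Bochner_Integration.integral_sum)
    show "integrable \<mu> (\<lambda>x. c i * (complex_of_real x ^ i * complex_of_real x ^ k))" for i
      using integrable_L2_product[OF power_L2[of i] power_L2[of k]]
      by (intro integrable_mult_right) (simp flip: of_real_power)
  qed (simp add: integral_power_mult)
  also have "\<dots> = (\<Sum>i\<in>?S. complex_of_real (w i) * cnj (?d i) * c i)"
    using weights by (intro sum.cong) (auto simp: less_imp_neq[symmetric])
  also have "\<dots> = ip (ell2 w) ?d c"
    using suminf_finite[OF c, of "\<lambda>i. complex_of_real (w i) * cnj (?d i) * c i"]
    by (simp add: ell2_def)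
  finally show "ip (L2 \<mu>) (\<lambda>x. complex_of_real x ^ k) q = ip (ell2 w) ?d c" .
qed (rule power_L2)

text \<open>The measure is finite, so the constant function 1 = x^0 is in \<open>L2 \<mu>\<close>
  and \<phi> is a product of two square integrable functions.\<close>

lemma integrable_L2:
  assumes "\<phi> \<in> vectors (L2 \<mu>)"
  shows "integrable \<mu> \<phi>"
  using integrable_L2_product[OF power_L2[of 0] assms] by simp

lemma hnorm_zero_of_orthogonal_powers:
  assumes h: "h \<in> vectors (L2 \<mu>)"
    and orth: "\<And>k. ip (L2 \<mu>) h (\<lambda>x. complex_of_real x ^ k) = 0"
  shows "hnorm (L2 \<mu>) h = 0"
proof -
  have "AE x in \<mu>. h x = 0"
  proof (rule AE_zero_of_moments_zero[OF finite_measure_axioms borel integrable_L2[OF h] AE_support])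
    fix k
    have "ip (L2 \<mu>) (\<lambda>x. complex_of_real x ^ k) h = 0"
      using orth[of k] H2.ip_commute[OF h power_L2] by simp
    then show "(\<integral>x. x ^ k *\<^sub>R h x \<partial>\<mu>) = 0"
      by (simp add: L2_def scaleR_conv_of_real)
  qed
  then have "(\<integral>x. (cmod (h x))\<^sup>2 \<partial>\<mu>) = 0"
    by (intro integral_eq_zero_AE) (auto elim: eventually_mono)
  then show ?thesis
    by (simp add: hnorm_L2)
qed

sublocale closable_operator "ell2 w" "L2 \<mu>" poly_graph
proof
  show "poly_graph \<subseteq> vectors (ell2 w) \<times> vectors (L2 \<mu>)"
    by (rule poly_graph_subset)
  have "(\<lambda>_. 0) \<in> fin_seqs" "poly_fun (\<lambda>_. 0) = (\<lambda>_. 0)"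
    by (simp_all add: fin_seqs_def poly_fun_def fun_eq_iff)
  then show zero: "((\<lambda>_. 0), (\<lambda>_. 0)) \<in> poly_graph"
    by auto
  show "((\<lambda>i. a * f i + b * f' i), (\<lambda>j. a * g j + b * g' j)) \<in> poly_graph"
    if "(f, g) \<in> poly_graph" "(f', g') \<in> poly_graph" for f g f' g' a b
    using that fin_seqs_lincomb by auto
  show "densely_defined (ell2 w) poly_graph"
    unfolding densely_defined_def
  proof (intro ballI allI impI)
    fix f e assume f: "f \<in> vectors (ell2 w)" and e: "0 < (e::real)"
    have "\<exists>g\<in>fin_seqs. hnorm (ell2 w) (f - g) < e"
    proof (rule H1.approx_of_orthogonal_trivial[OF _ _ fin_seqs_lincomb(1) _ f e])
      show "fin_seqs \<subseteq> vectors (ell2 w)"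
        using fin_seqs_ell2 by auto
      show "(\<lambda>_. 0) \<in> fin_seqs"
        by (simp add: fin_seqs_def)
      fix h assume "\<And>s. s \<in> fin_seqs \<Longrightarrow> ip (ell2 w) h s = 0"
      \<comment> \<open>Testing against \<open>unit_seq j\<close> kills the j-th coordinate of
        h.\<close>
      then have "complex_of_real (w j) * cnj (h j) = 0" for j
        using unit_seq_fin_seqs[of j] by (simp flip: ip_unit_seq)
      then have "h = (\<lambda>_. 0)"
        using weights by (auto simp: fun_eq_iff less_imp_neq[symmetric])
      then show "hnorm (ell2 w) h = 0"
        using H1.hnorm_zero by simp
    qed
    then show "\<exists>g\<in>Domain poly_graph. hnorm (ell2 w) (f - g) < e"
      by auto
  qed
  let ?A = "adjoint_op (ell2 w) (L2 \<mu>) poly_graph"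
  note A = H1.hilbert_space_axioms H2.hilbert_space_axioms poly_graph_subset
  show "densely_defined (L2 \<mu>) ?A"
    unfolding densely_defined_def
  proof (intro ballI allI impI)
    fix f e assume f: "f \<in> vectors (L2 \<mu>)" and e: "0 < (e::real)"
    show "\<exists>g\<in>Domain ?A. hnorm (L2 \<mu>) (f - g) < e"
    proof (rule H2.approx_of_orthogonal_trivial[OF _ _ _ _ f e])
      show "Domain ?A \<subseteq> vectors (L2 \<mu>)"
        by (auto simp: mem_adjoint_op_iff)
      show "(\<lambda>_. 0) \<in> Domain ?A"
        using adjoint_op_zero[OF A] by blast
      show "(\<lambda>i. a * f i + b * g i) \<in> Domain ?A" if "f \<in> Domain ?A" "g \<in> Domain ?A" for f g a b
        using that adjoint_op_lincomb[OF A] by (meson Domain_iff)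
      fix h assume h: "h \<in> vectors (L2 \<mu>)" "\<And>s. s \<in> Domain ?A \<Longrightarrow> ip (L2 \<mu>) h s = 0"
      \<comment> \<open>All monomials lie in \<open>Domain ?A\<close>, so h has vanishing
        moments.\<close>
      show "hnorm (L2 \<mu>) h = 0"
        by (intro hnorm_zero_of_orthogonal_powers h DomainI[OF power_mem_adjoint])
    qed
  qed
qed

section \<open>Coefficients, point evaluation and the integral kernel\<close>

lemma T_eq: "T = F_op w \<mu>"
  by (simp add: F_op_def)

text \<open>The adjoint relation is tested on unit sequences, whose polynomials are the
  monomials.\<close>

lemma F_adj_coeff:
  assumes "(\<phi>, c) \<in> F_adj w \<mu>"
  shows "c j = (\<integral>x. complex_of_real x ^ j * \<phi> x \<partial>\<mu>) / complex_of_real (w j)"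
proof -
  have adj: "(\<phi>, c) \<in> T_adj"
    using assms by (simp add: F_adj_def T_eq)
  have "(unit_seq j, poly_fun (unit_seq j)) \<in> poly_graph"
    using unit_seq_fin_seqs by blast
  with adj have "ip (L2 \<mu>) \<phi> (poly_fun (unit_seq j)) = ip (ell2 w) c (unit_seq j)"
    unfolding T_adj_iff by blast
  then have "ip (L2 \<mu>) \<phi> (\<lambda>x. complex_of_real x ^ j) = complex_of_real (w j) * cnj (c j)"
    by (simp add: poly_fun_unit_seq ip_unit_seq)
  then have "ip (L2 \<mu>) (\<lambda>x. complex_of_real x ^ j) \<phi> = complex_of_real (w j) * c j"
    using H2.ip_commute[OF T_adj_D(1)[OF adj] power_L2[of j]] by simp
  then show ?thesis
    using weights[of j] by (simp add: L2_def)
qed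

text \<open>For almost every \<open>x\<close>, evaluation at \<open>x\<close> is a bounded functional on \<open>ell2 w\<close>.\<close>

lemma F_op_power_series:
  assumes "(c, \<psi>) \<in> F_op w \<mu>"
  shows "AE x in \<mu>. \<psi> x = (\<Sum>j. complex_of_real x ^ j * c j)"
proof -
  have T: "(c, \<psi>) \<in> T"
    using assms by (simp add: T_eq)
  note mem = T_D[OF T]
  \<comment> \<open>Geometric error bounds make the errors summable, hence convergent to zero, at
    almost every point, so no further subsequence is required.\<close>
  have "\<exists>d. d \<in> fin_seqs \<and> hnorm (ell2 w) (c - d) < (1/2) ^ n
      \<and> hnorm (L2 \<mu>) (\<psi> - poly_fun d) < (1/2) ^ n" for n :: nat
    using T unfolding T_iff by (force dest: spec[of _ "(1/2) ^ n"])
  then obtain d where d: "\<And>n::nat. d n \<in> fin_seqs" "\<And>n. hnorm (ell2 w) (c - d n) < (1/2) ^ n"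
    "\<And>n. hnorm (L2 \<mu>) (\<psi> - poly_fun (d n)) < (1/2) ^ n"
    by metis
  have d_mem: "d n \<in> vectors (ell2 w)" for n
    by (rule fin_seqs_ell2[OF d(1)])
  have d_lim: "(\<lambda>n. hnorm (ell2 w) (d n - c)) \<longlonglongrightarrow> 0"
  proof (rule Lim_null_comparison)
    show "\<forall>\<^sub>F n in sequentially. norm (hnorm (ell2 w) (d n - c)) \<le> (1/2) ^ n"
      using d(2) H1.hnorm_commute[OF mem(1) d_mem] H1.hnorm_nonneg[OF H1.diff_mem[OF d_mem mem(1)]]
      by (intro always_eventually) (auto intro: less_imp_le)
  qed (simp add: LIMSEQ_power_zero)
  have sum: "AE x in \<mu>. summable (\<lambda>n. cmod ((\<psi> - poly_fun (d n)) x))"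
    by (intro AE_summable_of_hnorm_L2 H2.diff_mem mem poly_fun_L2 less_imp_le d)
  obtain r where r: "0 \<le> r" "AE x in \<mu>. \<bar>x\<bar> \<le> r"
    "AE x in \<mu>. summable (\<lambda>j. (\<bar>x\<bar> * r) ^ j / w j)"
    by (rule essential_radius)
  from sum r(2,3) show ?thesis
  proof eventually_elim
    case (elim x)
    have "\<bar>x * x\<bar> \<le> \<bar>x\<bar> * r"
      unfolding abs_mult using elim(2) by (rule mult_left_mono) simp
    with elim(3) have x2: "summable (\<lambda>j. (x * x) ^ j / w j)"
      by (rule summable_power_mono(2))
    \<comment> \<open>The representer of evaluation at x in \<open>ell2 w\<close>; its squared norm
      is k(x, x), finite by \<open>x2\<close>.\<close>
    let ?e = "\<lambda>j. complex_of_real (x ^ j / w j)"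
    have e: "?e \<in> vectors (ell2 w)"
    proof -
      have "w j * (cmod (?e j))\<^sup>2 = (x * x) ^ j / w j" for j
      proof -
        have "cmod (?e j) = \<bar>x ^ j\<bar> / w j"
          using weights[of j] by (simp only: norm_of_real abs_divide abs_of_pos)
        then have "w j * (cmod (?e j))\<^sup>2 = (x ^ j)\<^sup>2 / w j"
          by (simp only: power_divide power2_abs) (simp add: power2_eq_square)
        then show ?thesis
          by (simp only: power2_eq_square power_mult_distrib)
      qed
      then show ?thesis
        using x2 by (simp add: mem_ell2_iff)
    qed
    have ip_e: "ip (ell2 w) ?e u = (\<Sum>j. complex_of_real x ^ j * u j)" for u
      using weights by (simp add: ell2_def less_imp_neq[symmetric])
    have "ip (ell2 w) ?e (d n) = poly_fun (d n) x" for n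
      unfolding ip_e poly_fun_def using d(1)[of n]
      by (subst suminf_finite[of "{i. d n i \<noteq> 0}"]) (auto simp: fin_seqs_def mult.commute)
    then have "(\<lambda>n. poly_fun (d n) x) \<longlonglongrightarrow> ip (ell2 w) ?e c"
      using H1.tendsto_ip_right[OF e d_mem mem(1) d_lim] by simp
    \<comment> \<open>The second limit of the same sequence; comparing the two identifies \<psi> x
      with the power series.\<close>
    moreover have "(\<lambda>n. poly_fun (d n) x) \<longlonglongrightarrow> \<psi> x"
    proof -
      have "(\<lambda>n. (\<psi> - poly_fun (d n)) x) \<longlonglongrightarrow> 0"
        using summable_LIMSEQ_zero[OF elim(1)] by (rule tendsto_norm_zero_cancel)
      then show ?thesis
        using tendsto_diff[OF tendsto_const[of "\<psi> x"]] by fastforce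
    qed
    ultimately show ?case
      using LIMSEQ_unique ip_e by metis
  qed
qed

lemma kernel_summable: "AE x in \<mu>. AE y in \<mu>. summable (\<lambda>j. (x * y) ^ j / w j)"
proof -
  obtain r where r: "0 \<le> r" "AE x in \<mu>. \<bar>x\<bar> \<le> r"
    "AE x in \<mu>. summable (\<lambda>j. (\<bar>x\<bar> * r) ^ j / w j)"
    by (rule essential_radius)
  from r(3) show ?thesis
  proof eventually_elim
    case x: (elim x)
    from r(2) show ?case
    proof eventually_elim
      case (elim y)
      show ?case
        by (rule summable_power_mono(2)[OF x]) (simp add: abs_mult elim mult_left_mono)
    qed
  qed
qed

text \<open>For almost every x the j-th term of the integrand is dominated by (|x| r)^j / w_j times
  |\<phi>|. The factors are summable and do not depend on y, which justifies integration term by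
  term.\<close>

lemma kernel_integral:
  assumes \<phi>: "\<phi> \<in> vectors (L2 \<mu>)"
  shows "AE x in \<mu>. integrable \<mu> (\<lambda>y. complex_of_real (K_kernel w x y) * \<phi> y)
    \<and> (\<integral>y. complex_of_real (K_kernel w x y) * \<phi> y \<partial>\<mu>)
      = (\<Sum>j. complex_of_real x ^ j * ((\<integral>y. complex_of_real y ^ j * \<phi> y \<partial>\<mu>) / complex_of_real (w j)))"
proof -
  obtain r where r: "0 \<le> r" "AE x in \<mu>. \<bar>x\<bar> \<le> r"
    "AE x in \<mu>. summable (\<lambda>j. (\<bar>x\<bar> * r) ^ j / w j)"
    by (rule essential_radius)
  note int = integrable_L2[OF \<phi>]
  from r(3) show ?thesis
  proof eventually_elim
    case x: (elim x)
    let ?f = "\<lambda>j y. complex_of_real ((x * y) ^ j / w j) * \<phi> y"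
    have bound: "\<bar>(x * y) ^ j / w j\<bar> \<le> (\<bar>x\<bar> * r) ^ j / w j" if "\<bar>y\<bar> \<le> r" for y j
    proof -
      have "\<bar>x * y\<bar> ^ j \<le> (\<bar>x\<bar> * r) ^ j"
        using that by (intro power_mono) (simp_all add: abs_mult mult_left_mono)
      then show ?thesis
        using weights[of j] by (simp add: power_abs divide_right_mono)
    qed
    have f_bound: "AE y in \<mu>. norm (?f j y) \<le> (\<bar>x\<bar> * r) ^ j / w j * norm (\<phi> y)" for j
      using r(2)
    proof eventually_elim
      case (elim y)
      show ?case
        using mult_right_mono[OF bound[OF elim, of j], of "norm (\<phi> y)"]
        by (simp only: norm_mult norm_of_real) simp
    qed
    have f_int: "integrable \<mu> (?f j)" for j
    proof -
      have meas: "(\<lambda>y. (x * y) ^ j / w j) \<in> borel_measurable \<mu>"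
        unfolding measurable_eq by measurable
      have "AE y in \<mu>. \<bar>(x * y) ^ j / w j\<bar> \<le> (\<bar>x\<bar> * r) ^ j / w j"
        using r(2) bound by (auto elim: eventually_mono)
      from integrable_bounded_scaleR[OF int meas this] show ?thesis
        by (simp only: scaleR_conv_of_real)
    qed
    have sum_norm: "AE y in \<mu>. summable (\<lambda>j. norm (?f j y))"
      using r(2)
    proof eventually_elim
      case (elim y)
      have "summable (\<lambda>j. \<bar>(x * y) ^ j / w j\<bar> * norm (\<phi> y))"
        using elim by (intro summable_mult2 summable_power_mono(1)[OF x])
          (simp add: abs_mult mult_left_mono)
      then show ?case by (simp only: norm_mult norm_of_real)
    qed
    have sum_int: "summable (\<lambda>j. \<integral>y. norm (?f j y) \<partial>\<mu>)"
    proof (rule summable_comparison_test)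
      show "summable (\<lambda>j. (\<bar>x\<bar> * r) ^ j / w j * (\<integral>y. norm (\<phi> y) \<partial>\<mu>))"
        by (intro summable_mult2 x)
      have "(\<integral>y. norm (?f j y) \<partial>\<mu>) \<le> (\<bar>x\<bar> * r) ^ j / w j * (\<integral>y. norm (\<phi> y) \<partial>\<mu>)" for j
      proof -
        have "(\<integral>y. norm (?f j y) \<partial>\<mu>) \<le> (\<integral>y. (\<bar>x\<bar> * r) ^ j / w j * norm (\<phi> y) \<partial>\<mu>)"
          by (intro integral_mono_AE f_bound integrable_norm f_int integrable_mult_right int)
        then show ?thesis by simp
      qed
      then show "\<exists>N. \<forall>j\<ge>N. norm (\<integral>y. norm (?f j y) \<partial>\<mu>)
          \<le> (\<bar>x\<bar> * r) ^ j / w j * (\<integral>y. norm (\<phi> y) \<partial>\<mu>)"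
        by (intro exI[of _ 0]) (simp del: of_real_divide of_real_power)
    qed
    note series = integrable_suminf[OF f_int sum_norm sum_int] integral_suminf[OF f_int sum_norm sum_int]
    \<comment> \<open>Where |y| > r the series may diverge and \<open>suminf\<close> carries no
      information, so the identity holds only almost everywhere; measurability of the kernel side is
      therefore shown on its own.\<close>
    have eq: "AE y in \<mu>. (\<Sum>j. ?f j y) = complex_of_real (K_kernel w x y) * \<phi> y"
      using r(2)
    proof eventually_elim
      case (elim y)
      have "summable (\<lambda>j. (x * y) ^ j / w j)"
        by (rule summable_power_mono(2)[OF x]) (simp add: abs_mult elim mult_left_mono)
      then show ?case
        unfolding K_kernel_def by (simp only: suminf_of_real suminf_mult2 summable_of_real)
    qed
    have meas: "(\<lambda>y. complex_of_real (K_kernel w x y) * \<phi> y) \<in> borel_measurable \<mu>"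
    proof -
      have "K_kernel w x \<in> borel_measurable \<mu>"
        unfolding K_kernel_def[abs_def] measurable_eq by measurable
      then show ?thesis
        using borel_measurable_integrable[OF int] by measurable
    qed
    have kernel_int: "integrable \<mu> (\<lambda>y. complex_of_real (K_kernel w x y) * \<phi> y)"
      using integrable_cong_AE[OF borel_measurable_integrable[OF series(1)] meas eq] series(1) by blast
    have kernel_eq: "(\<integral>y. complex_of_real (K_kernel w x y) * \<phi> y \<partial>\<mu>) = (\<Sum>j. \<integral>y. ?f j y \<partial>\<mu>)"
      using integral_cong_AE[OF borel_measurable_integrable[OF series(1)] meas eq] series(2) by (rule trans[OF sym])
    have coeff: "(\<integral>y. ?f j y \<partial>\<mu>)
        = complex_of_real x ^ j * ((\<integral>y. complex_of_real y ^ j * \<phi> y \<partial>\<mu>) / complex_of_real (w j))" for j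
    proof -
      let ?a = "complex_of_real x ^ j / complex_of_real (w j)"
      have "(\<integral>y. ?f j y \<partial>\<mu>) = (\<integral>y. ?a * (complex_of_real y ^ j * \<phi> y) \<partial>\<mu>)"
        by (intro Bochner_Integration.integral_cong refl) (simp add: power_mult_distrib)
      also have "\<dots> = ?a * (\<integral>y. complex_of_real y ^ j * \<phi> y \<partial>\<mu>)"
        by (rule integral_mult_right_zero)
      finally show ?thesis by simp
    qed
    show ?case
      using kernel_int kernel_eq unfolding coeff by blast
  qed
qed

text \<open>With c the adjoint applied to \<phi>, \<psi> is the power series with coefficients c_j.
  Inserting their integral formula gives the interchanged sum of
  \<open>kernel_integral\<close>.\<close>

lemma K_op_kernel:
  assumes "(\<phi>, \<psi>) \<in> K_op w \<mu>"
  shows "AE x in \<mu>. integrable \<mu> (\<lambda>y. complex_of_real (K_kernel w x y) * \<phi> y)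
    \<and> \<psi> x = (\<integral>y. complex_of_real (K_kernel w x y) * \<phi> y \<partial>\<mu>)"
proof -
  obtain c where c: "(\<phi>, c) \<in> F_adj w \<mu>" "(c, \<psi>) \<in> F_op w \<mu>"
    using assms by (auto simp: K_op_def)
  have "\<phi> \<in> vectors (L2 \<mu>)"
    using c(1) by (auto simp: F_adj_def adjoint_op_def)
  from kernel_integral[OF this] F_op_power_series[OF c(2)] show ?thesis
    by eventually_elim (simp add: F_adj_coeff[OF c(1)])
qed

end

theorem proposition6p4:
  fixes \<mu> :: "real measure" and w :: "nat \<Rightarrow> real"
  assumes borel: "sets \<mu> = sets borel"
    and supp: "measure_support \<mu> \<subseteq> {-1..1}"
    and mom: "\<And>j::nat. integrable \<mu> (\<lambda>x. x ^ j)"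
    and weights: "\<And>i. w i > 0"
    and sum_mom: "\<And>k::nat. summable (\<lambda>j. (1 / w j) * \<bar>moment \<mu> (j + k)\<bar>\<^sup>2)"
  shows "linear_operator (ell2 w) (L2 \<mu>) (F_op w \<mu>)
    \<and> densely_defined (L2 \<mu>) (F_adj w \<mu>)
    \<and> self_adjoint (L2 \<mu>) (K_op w \<mu>)
    \<and> (AE x in \<mu>. AE y in \<mu>. summable (\<lambda>j. (x * y) ^ j / w j))
    \<and> (\<forall>(\<phi>, \<psi>) \<in> K_op w \<mu>. AE x in \<mu>.
          integrable \<mu> (\<lambda>y. complex_of_real (K_kernel w x y) * \<phi> y)
          \<and> \<psi> x = (\<integral>y. complex_of_real (K_kernel w x y) * \<phi> y \<partial>\<mu>))"
proof -
  interpret moment_operator \<mu> w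
    by unfold_locales (fact assms)+
  have "linear_operator (ell2 w) (L2 \<mu>) (F_op w \<mu>)"
    using linear_operator_T by (simp only: T_eq)
  moreover have "densely_defined (L2 \<mu>) (F_adj w \<mu>)"
    \<comment> \<open>The density is known for the adjoint on finitely supported sequences;
      \<open>T_adj_eq\<close> transfers it to the closure.\<close>
    using adjoint_dense by (simp only: F_adj_def T_adj_eq flip: T_eq)
  moreover have "self_adjoint (L2 \<mu>) (K_op w \<mu>)"
    using self_adjoint_K by (simp only: K_op_def F_adj_def T_eq)
  ultimately show ?thesis
    using kernel_summable K_op_kernel by blast
qed

end
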